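(* Let $m\ge 2$ and let $K\ne\Delta_{[m]}$ be a simplicial complex on $[m]$. Then (a) $m-1\le\chi(\mathrm{Bier}(K))\le m$; and (b) $\chi(\mathrm{Bier}(K))=m-1$ if and only if $\mathrm{Bier}(K)$ is polytopal and either $P_K$ is combinatorially equivalent to the cube $I^{m-1}$, or $m\ge 3$ and $P_K$ is combinatorially equivalent to $I^{m-3}\times P_6$, where $P_6$ is a hexagon.
   Context: A simplicial complex $K$ on $[m]=\{1,\dots,m\}$ is a nonempty family of subsets of $[m]$ closed under taking subsets; $V(K)=\{i:\{i\}\in K\}$. $\Delta_{[m]}=2^{[m]}$. Let $[m']=\{1',\dots,m'\}$ be a disjoint copy of $[m]$, $I'=\{i':i\in I\}$. For $K\ne\Delta_{[m]}$ the Alexander dual $K^\vee$ is the complex on $[m']$ with $J'\in K^\vee$ iff $[m]\setminus J\notin K$. The Bier sphere $\mathrm{Bier}(K)$ is the complex on $[m]\sqcup[m']$ with faces $I\sqcup J'$, $I\in K$, $J'\in K^\vee$, $I\cap J=\varnothing$; it is an $(m-2)$-dimensional PL sphere. The chromatic number $\chi(L)$ is the least number of colors in a map $c\colon V(L)\to C$ with $c(u)\ne c(v)$ whenever $\{u,v\}\in L$. $\mathrm{Bier}(K)$ is polytopal if it is simplicially isomorphic to the boundary complex of a convex simplicial polytope; in that case $P_K$ denotes a simple $(m-1)$-polytope whose dual $P_K^*$ has boundary complex isomorphic to $\mathrm{Bier}(K)$ (equivalently, the nerve complex of facets of $P_K$ is $\mathrm{Bier}(K)$). $I^n$ is the $n$-dimensional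 cube ($I^0$ a point). *)

theory Defs
  imports "HOL-Analysis.Analysis"
begin

definition is_simplicial_complex_on :: "nat \<Rightarrow> nat set set \<Rightarrow> bool" where
  "is_simplicial_complex_on m K \<longleftrightarrow>
     K \<noteq> {} \<and> (\<forall>I\<in>K. I \<subseteq> {1..m}) \<and> (\<forall>I\<in>K. \<forall>J. J \<subseteq> I \<longrightarrow> J \<in> K)"

definition full_simplex :: "nat \<Rightarrow> nat set set" where
  "full_simplex m = Pow {1..m}"

text \<open>Alexander dual, with the copy [m'] identified with [m] via J' <-> J.\<close>
definition alexander_dual :: "nat \<Rightarrow> nat set set \<Rightarrow> nat set set" where
  "alexander_dual m K = {J. J \<subseteq> {1..m} \<and> {1..m} - J \<notin> K}"

text \<open>Bier sphere on [m] disjoint-union [m']: i is Inl i, i' is Inr i.\<close>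
definition bier :: "nat \<Rightarrow> nat set set \<Rightarrow> (nat + nat) set set" where
  "bier m K = {Inl ` I \<union> Inr ` J | I J. I \<in> K \<and> J \<in> alexander_dual m K \<and> I \<inter> J = {}}"

definition vertices :: "'v set set \<Rightarrow> 'v set" where
  "vertices L = {v. {v} \<in> L}"

definition proper_colouring :: "'v set set \<Rightarrow> nat \<Rightarrow> ('v \<Rightarrow> nat) \<Rightarrow> bool" where
  "proper_colouring L k c \<longleftrightarrow>
     (\<forall>v\<in>vertices L. c v < k) \<and> (\<forall>u v. {u, v} \<in> L \<and> u \<noteq> v \<longrightarrow> c u \<noteq> c v)"

definition chromatic_number :: "'v set set \<Rightarrow> nat" where
  "chromatic_number L = (LEAST k. \<exists>c. proper_colouring L k c)"

definition simp_iso :: "'a set set \<Rightarrow> 'b set set \<Rightarrow> bool" where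
  "simp_iso L1 L2 \<longleftrightarrow> (\<exists>f. bij_betw f (\<Union>L1) (\<Union>L2) \<and> (image f) ` L1 = L2)"

definition simplicial_polytope :: "'a::euclidean_space set \<Rightarrow> bool" where
  "simplicial_polytope P \<longleftrightarrow> polytope P \<and>
     (\<forall>F. F facet_of P \<longrightarrow> (aff_dim P - 1) simplex F)"

definition simple_polytope :: "'a::euclidean_space set \<Rightarrow> bool" where
  "simple_polytope P \<longleftrightarrow> polytope P \<and>
     (\<forall>v. v extreme_point_of P \<longrightarrow> int (card {F. F facet_of P \<and> v \<in> F}) = aff_dim P)"

definition boundary_complex :: "'a::euclidean_space set \<Rightarrow> 'a set set" where
  "boundary_complex P = {{v. v extreme_point_of F} | F. F face_of P \<and> F \<noteq> P}"

definition facet_nerve :: "'a::euclidean_space set \<Rightarrow> 'a set set set" where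
  "facet_nerve P = {S. S \<subseteq> {F. F facet_of P} \<and> \<Inter>S \<noteq> {}}"

definition comb_equiv :: "'a::euclidean_space set \<Rightarrow> 'b::euclidean_space set \<Rightarrow> bool" where
  "comb_equiv P Q \<longleftrightarrow> (\<exists>f. bij_betw f {F. F face_of P} {G. G face_of Q} \<and>
     (\<forall>F1 F2. F1 face_of P \<longrightarrow> F2 face_of P \<longrightarrow> (F1 \<subseteq> F2 \<longleftrightarrow> f F1 \<subseteq> f F2)))"

text \<open>Bier(K) polytopal, realized in R^n with n = CARD('n) = m - 1.\<close>
definition bier_polytopal :: "'n::finite itself \<Rightarrow> nat \<Rightarrow> nat set set \<Rightarrow> bool" where
  "bier_polytopal _ m K \<longleftrightarrow> (\<exists>P :: (real ^ 'n) set.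
     simplicial_polytope P \<and> aff_dim P = int CARD('n) \<and> simp_iso (boundary_complex P) (bier m K))"

definition is_P_K :: "nat \<Rightarrow> nat set set \<Rightarrow> (real ^ 'n::finite) set \<Rightarrow> bool" where
  "is_P_K m K Q \<longleftrightarrow> simple_polytope Q \<and> aff_dim Q = int CARD('n) \<and>
     simp_iso (facet_nerve Q) (bier m K)"

definition unit_cube :: "(real ^ 'n::finite) set" where
  "unit_cube = {x. \<forall>i. 0 \<le> x $ i \<and> x $ i \<le> 1}"

definition hexagon :: "(real \<times> real) set" where
  "hexagon = convex hull {(0,1), (1,0), (2,0), (3,1), (2,2), (1,2)}"

definition cube_hex_prism :: "'n \<Rightarrow> 'n \<Rightarrow> (real ^ 'n::finite) set" where
  "cube_hex_prism a b = {x. (\<forall>i. i \<noteq> a \<and> i \<noteq> b \<longrightarrow> 0 \<le> x $ i \<and> x $ i \<le> 1) \<and>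
      (x $ a, x $ b) \<in> hexagon}"

end

theory Submission
  imports Defs
begin

text \<open>A facet of \<open>Bier(K)\<close> is a pair \<open>(I, x)\<close> with \<open>I \<in> K\<close> and \<open>I \<union> {x} \<notin> K\<close>, so giving \<open>i\<close> and \<open>i'\<close>
  the colour \<open>i\<close> yields the upper bound, and the \<open>m - 1\<close> vertices of a facet the lower one. In a colouring
  with \<open>m - 1\<close> colours the two apexes over a ridge have the same colour. Read off on the squares
  \<open>I, I \<union> {a}, I \<union> {x}, I \<union> {a, x}\<close> crossing the boundary of \<open>K\<close>, this forces all minimal non-faces of
  \<open>K\<close> to have at most two elements and then leaves four shapes of \<open>K\<close>: a simplex on \<open>m - 1\<close> or on
  \<open>m - 2\<close> of the points, one missing edge, or three missing edges forming a triangle. The first three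
  give the boundary of a cross-polytope, the last one its join with a hexagon; both are realized
  explicitly. Conversely, the facets of the cube and of the hexagonal prism are coloured with
  \<open>m - 1\<close> colours by giving opposite facets of the cube factor, and alternate sides of the
  hexagon, the same colour.\<close>

section \<open>Colourings of Bier spheres\<close>

text \<open>The statement asks for Bier(K) both as the boundary of a simplicial polytope and as the
  facet nerve of a simple one. Rather than passing between the two by polarity, both are built on
  one combinatorial model, \<open>conflict_free D T\<close>, whose elements \<open>(i, s)\<close>
  index the vertices of the former and the facets of the latter. With
  \<open>CARD('n) = m - 1\<close>, the cross-polytope has m - 1 opposite pairs, indexed by
  \<open>Some i\<close>; the join with a hexagon has m pairs in the same dimension, and
  \<open>None\<close> indexes the extra one. A colour equality is of use only against an edge of
  Bier(K). Edges with primed end points exist as soon as the complement of their primed part is a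
  non-face; so points that are not vertices, and missing edges, are harmful whenever they survive in
  such a complement. This is what limits the number of non-vertices and of missing edges of K. For
  the converse only an isomorphism of face lattices is given, so the colouring is carried over by
  inclusions of faces alone.\<close>

lemma bier_iff:
  "X \<in> bier m K \<longleftrightarrow> {i. Inl i \<in> X} \<in> K \<and> {i. Inr i \<in> X} \<in> alexander_dual m K \<and>
     (\<forall>i. \<not> (Inl i \<in> X \<and> Inr i \<in> X))"
proof
  assume "X \<in> bier m K"
  then obtain I J where X: "X = Inl ` I \<union> Inr ` J" and *: "I \<in> K" "J \<in> alexander_dual m K" "I \<inter> J = {}"
    unfolding bier_def by blast
  have "{i. Inl i \<in> X} = I" "{i. Inr i \<in> X} = J" using X by auto
  with * show "{i. Inl i \<in> X} \<in> K \<and> {i. Inr i \<in> X} \<in> alexander_dual m K \<and>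
     (\<forall>i. \<not> (Inl i \<in> X \<and> Inr i \<in> X))" by auto
next
  assume r: "{i. Inl i \<in> X} \<in> K \<and> {i. Inr i \<in> X} \<in> alexander_dual m K \<and>
     (\<forall>i. \<not> (Inl i \<in> X \<and> Inr i \<in> X))"
  have X: "X = Inl ` {i. Inl i \<in> X} \<union> Inr ` {i. Inr i \<in> X}"
  proof (intro set_eqI)
    fix z show "z \<in> X \<longleftrightarrow> z \<in> Inl ` {i. Inl i \<in> X} \<union> Inr ` {i. Inr i \<in> X}"
      by (cases z) auto
  qed
  have "{i. Inl i \<in> X} \<inter> {i. Inr i \<in> X} = {}" using r by auto
  with r show "X \<in> bier m K" unfolding bier_def mem_Collect_eq
    by (intro exI conjI) (rule X, simp_all)
qed

lemma proper_colouring_inj_on: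
  assumes "proper_colouring L k c" "X \<in> L" and down: "\<And>X Y. X \<in> L \<Longrightarrow> Y \<subseteq> X \<Longrightarrow> Y \<in> L"
  shows "inj_on c X" "c ` X \<subseteq> {..<k}"
proof -
  show "inj_on c X"
  proof (rule inj_onI, rule ccontr)
    fix x y assume *: "x \<in> X" "y \<in> X" "c x = c y" "x \<noteq> y"
    then have "{x,y} \<in> L" using down[OF assms(2), of "{x,y}"] by simp
    with * assms(1) show False unfolding proper_colouring_def by blast
  qed
  show "c ` X \<subseteq> {..<k}"
  proof
    fix y assume "y \<in> c ` X"
    then obtain x where x: "x \<in> X" "y = c x" by blast
    then have "{x} \<in> L" using down[OF assms(2), of "{x}"] by simp
    then show "y \<in> {..<k}" using assms(1) x unfolding proper_colouring_def vertices_def by auto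
  qed
qed

lemma chromatic_number_le: "proper_colouring L k c \<Longrightarrow> chromatic_number L \<le> k"
  unfolding chromatic_number_def by (rule Least_le) blast

lemma chromatic_number_colouring:
  assumes "proper_colouring L k c"
  shows "\<exists>c. proper_colouring L (chromatic_number L) c"
  unfolding chromatic_number_def
  using LeastI[of "\<lambda>k. \<exists>c. proper_colouring L k c" k] assms by blast

section \<open>Facets of Bier spheres and the two bounds on the chromatic number\<close>

locale proper_subcomplex =
  fixes m :: nat and K :: "nat set set"
  assumes complex: "is_simplicial_complex_on m K" and not_full: "K \<noteq> full_simplex m"
begin

lemma down: "I \<in> K \<Longrightarrow> J \<subseteq> I \<Longrightarrow> J \<in> K"
  using complex unfolding is_simplicial_complex_on_def by auto

lemma face_subset: "I \<in> K \<Longrightarrow> I \<subseteq> {1..m}"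
  using complex unfolding is_simplicial_complex_on_def by blast

lemma finite_face: "I \<in> K \<Longrightarrow> finite I"
  by (rule finite_subset[OF face_subset]) simp_all

lemma empty_face: "{} \<in> K"
proof -
  obtain I where "I \<in> K" using complex unfolding is_simplicial_complex_on_def by auto
  then show ?thesis by (rule down) simp
qed

lemma ground_not_face: "{1..m} \<notin> K"
proof
  assume "{1..m} \<in> K"
  then have "K = full_simplex m"
    unfolding full_simplex_def using down[of "{1..m}"] face_subset by auto
  with not_full show False by blast
qed

lemma finite_complex: "finite K"
  by (rule finite_subset[of _ "Pow {1..m}"]) (use face_subset in auto)

lemma bier_down: "X \<in> bier m K \<Longrightarrow> Y \<subseteq> X \<Longrightarrow> Y \<in> bier m K"
proof -
  assume X: "X \<in> bier m K" and "Y \<subseteq> X"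
  have "{i. Inl i \<in> Y} \<in> K"
    by (rule down[of "{i. Inl i \<in> X}"]) (use X[unfolded bier_iff] \<open>Y \<subseteq> X\<close> in auto)
  moreover have "{i. Inr i \<in> Y} \<in> alexander_dual m K"
  proof -
    have *: "{i. Inr i \<in> Y} \<subseteq> {i. Inr i \<in> X}" using \<open>Y \<subseteq> X\<close> by auto
    have "{i. Inr i \<in> X} \<in> alexander_dual m K" using X by (simp add: bier_iff)
    with * show ?thesis
      using down[of "{1..m} - {i. Inr i \<in> Y}" "{1..m} - {i. Inr i \<in> X}"]
      unfolding alexander_dual_def by auto
  qed
  ultimately show ?thesis using X \<open>Y \<subseteq> X\<close> unfolding bier_iff by blast
qed

text \<open>Every element of the ground set except x contributes exactly one of its two copies,
  hence the m - 1 vertices counted below.\<close>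

definition bier_facet :: "nat set \<Rightarrow> nat \<Rightarrow> (nat + nat) set" where
  "bier_facet I x = Inl ` I \<union> Inr ` ({1..m} - insert x I)"

lemma bier_facet:
  assumes "I \<in> K" "insert x I \<notin> K" "x \<in> {1..m}"
  shows "bier_facet I x \<in> bier m K" "finite (bier_facet I x)" "card (bier_facet I x) = m - 1"
proof -
  have xI: "x \<notin> I" using assms by (auto simp: insert_absorb)
  have I: "I \<subseteq> {1..m}" by (rule face_subset) (rule assms)
  \<comment> \<open>The complement of the primed part is \<open>insert x I\<close>, so membership in
    the dual is the assumption that this set is a non-face.\<close>
  have "{1..m} - ({1..m} - insert x I) = insert x I" using assms I by auto
  then have "{1..m} - insert x I \<in> alexander_dual m K"
    using assms unfolding alexander_dual_def by simp
  then show "bier_facet I x \<in> bier m K"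
    unfolding bier_def bier_facet_def mem_Collect_eq using assms(1)
    by (intro exI[of _ I] exI[of _ "{1..m} - insert x I"]) auto
  have f: "finite I" by (rule finite_face) (rule assms)
  then show "finite (bier_facet I x)" by (simp add: bier_facet_def)
  have "card (bier_facet I x) = card (Inl ` I :: (nat+nat) set) + card (Inr ` ({1..m} - insert x I) :: (nat+nat) set)"
    unfolding bier_facet_def by (rule card_Un_disjoint) (use f in auto)
  also have "\<dots> = card I + (m - card (insert x I))"
    using f I assms by (simp add: card_image card_Diff_subset)
  also have "\<dots> = m - 1"
  proof -
    have "card (insert x I) \<le> m" using I assms card_mono[of "{1..m}" "insert x I"] by simp
    then show ?thesis using f xI by simp
  qed
  finally show "card (bier_facet I x) = m - 1" .
qed

lemma proper_colouring_bier: "proper_colouring (bier m K) m (\<lambda>z. case z of Inl i \<Rightarrow> i - 1 | Inr i \<Rightarrow> i - 1)"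
proof -
  have sub: "i \<in> {1..m}" if X: "X \<in> bier m K" and i: "Inl i \<in> X \<or> Inr i \<in> X" for X i
  proof -
    have "{i. Inl i \<in> X} \<subseteq> {1..m}" using X face_subset unfolding bier_iff by blast
    moreover have "{i. Inr i \<in> X} \<subseteq> {1..m}" using X unfolding bier_iff alexander_dual_def by blast
    ultimately show ?thesis using i by blast
  qed
  show ?thesis unfolding proper_colouring_def
  proof (intro conjI ballI allI impI)
    fix v assume v: "v \<in> vertices (bier m K)"
    show "(case v of Inl i \<Rightarrow> i - 1 | Inr i \<Rightarrow> i - 1) < m"
      using sub[of "{v}"] v by (cases v) (fastforce simp: vertices_def)+
  next
    fix u v assume uv: "{u, v} \<in> bier m K \<and> u \<noteq> v"
    then have "\<not> (Inl i \<in> {u,v} \<and> Inr i \<in> {u,v})" for i by (simp only: bier_iff) blast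
    \<comment> \<open>Colours start at 0, hence the shift to \<open>i - 1\<close>; truncated
      subtraction is injective only on positive indices.\<close>
    moreover have "i \<ge> 1" if "Inl i \<in> {u,v} \<or> Inr i \<in> {u,v}" for i
      using sub[OF _ that] uv by simp
    ultimately show "(case u of Inl i \<Rightarrow> i - 1 | Inr i \<Rightarrow> i - 1) \<noteq> (case v of Inl i \<Rightarrow> i - 1 | Inr i \<Rightarrow> i - 1)"
      using uv by (cases u; cases v) (fastforce simp: le_Suc_eq dest: le_antisym)+
  qed
qed

text \<open>A maximal face above A works: it is not the whole ground set, and adding any outside
  point leaves K. The clause about all outside points serves to compare two of them by
  \<open>colour_eq_of_copair\<close>.\<close>

lemma exists_crossing:
  assumes "A \<in> K"
  obtains I x where "A \<subseteq> I" "I \<in> K" "x \<in> {1..m}" "\<And>x. x \<in> {1..m} - I \<Longrightarrow> insert x I \<notin> K" "x \<notin> I"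
proof -
  obtain I where I: "I \<in> K" "A \<subseteq> I" "\<forall>J\<in>K. I \<subseteq> J \<longrightarrow> I = J"
    using finite_has_maximal2[OF finite_complex assms] by auto
  then have "I \<subset> {1..m}" using ground_not_face face_subset[OF I(1)] by (auto simp: psubset_eq)
  then obtain x where x: "x \<in> {1..m}" "x \<notin> I" by (meson psubset_imp_ex_mem DiffD1 DiffD2)
  have "insert y I \<notin> K" if "y \<in> {1..m} - I" for y
    using I(3) that by auto
  with that[OF I(2,1) x(1) _ x(2)] show ?thesis by auto
qed

lemma chromatic_number_bounds:
  "m - 1 \<le> chromatic_number (bier m K)" "chromatic_number (bier m K) \<le> m"
proof -
  show "chromatic_number (bier m K) \<le> m"
    using proper_colouring_bier by (rule chromatic_number_le)
  obtain c where c: "proper_colouring (bier m K) (chromatic_number (bier m K)) c"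
    using chromatic_number_colouring[OF proper_colouring_bier] by blast
  obtain I x where I: "I \<in> K" "x \<in> {1..m}" "insert x I \<notin> K"
    by (rule exists_crossing[OF empty_face]) auto
  note F = bier_facet[OF I(1,3,2)]
  have "card (bier_facet I x) \<le> card {..<chromatic_number (bier m K)}"
    by (rule card_inj_on_le[OF proper_colouring_inj_on[OF c F(1) bier_down]]) simp_all
  then show "m - 1 \<le> chromatic_number (bier m K)" using F(3) by simp
qed

end

section \<open>Colour equalities and inequalities for m - 1 colours\<close>

locale balanced_bier = proper_subcomplex +
  fixes c :: "nat + nat \<Rightarrow> nat"
  assumes colouring: "proper_colouring (bier m K) (m - 1) c"
begin

lemma colour_facet:
  assumes "X \<in> bier m K" "finite X" "card X = m - 1"
  shows "inj_on c X" "c ` X = {..<m - 1}"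
proof -
  show inj: "inj_on c X"
    by (rule proper_colouring_inj_on[OF colouring assms(1) bier_down])
  have "c ` X \<subseteq> {..<m - 1}"
    by (rule proper_colouring_inj_on[OF colouring assms(1) bier_down])
  then show "c ` X = {..<m - 1}"
    using inj assms(3) by (intro card_subset_eq) (simp_all add: card_image)
qed

text \<open>Two facets sharing a ridge miss the same colour there, so their apexes agree in colour.\<close>
lemma colour_apex_eq:
  assumes "insert p R \<in> bier m K" "finite (insert p R)" "card (insert p R) = m - 1"
    and "insert q R \<in> bier m K" "finite (insert q R)" "card (insert q R) = m - 1"
    and "p \<notin> R" "q \<notin> R"
  shows "c p = c q"
proof -
  note P = colour_facet[OF assms(1-3)] and Q = colour_facet[OF assms(4-6)]
  have "c p \<notin> c ` R" "c q \<notin> c ` R" using P(1) Q(1) assms(7,8) by (auto simp: inj_on_def)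
  moreover have "insert (c p) (c ` R) = insert (c q) (c ` R)" using P(2) Q(2) by simp
  ultimately show ?thesis by blast
qed

text \<open>The square over I with only its top outside K: \<open>bier_facet (insert a I) x\<close>
  and \<open>bier_facet (insert x I) a\<close> differ only in the apexes a and x.\<close>

lemma colour_eq_of_pair:
  assumes "insert a I \<in> K" "insert x I \<in> K" "insert a (insert x I) \<notin> K" "a \<notin> I" "x \<notin> I"
  shows "c (Inl a) = c (Inl x)"
proof -
  have ax: "a \<noteq> x" using assms by auto
  have g: "a \<in> {1..m}" "x \<in> {1..m}" using face_subset assms by blast+
  let ?R = "Inl ` I \<union> Inr ` ({1..m} - insert a (insert x I))"
  have 1: "insert (Inl a) ?R = bier_facet (insert a I) x"
    and 2: "insert (Inl x) ?R = bier_facet (insert x I) a"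
    using assms by (auto simp: bier_facet_def)
  have "insert x (insert a I) \<notin> K" using assms(3) by (simp add: insert_commute)
  note F = bier_facet[OF assms(1) this g(2), folded 1] bier_facet[OF assms(2,3) g(1), folded 2]
  show ?thesis by (rule colour_apex_eq[OF F]) (use assms ax in auto)
qed

text \<open>The square with only its bottom I in K: \<open>bier_facet I x\<close> contains a' but
  not x', and \<open>bier_facet I a\<close> contains x' but not a'.\<close>

lemma colour_eq_of_copair:
  assumes "I \<in> K" "insert a I \<notin> K" "insert x I \<notin> K" "a \<in> {1..m}" "x \<in> {1..m}"
  shows "c (Inr a) = c (Inr x)"
proof (cases "a = x")
  case False
  let ?R = "Inl ` I \<union> Inr ` ({1..m} - insert a (insert x I))"
  have n: "a \<notin> I" "x \<notin> I" using assms by (auto simp: insert_absorb)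
  have 1: "insert (Inr a) ?R = bier_facet I x" and 2: "insert (Inr x) ?R = bier_facet I a"
    using n False assms by (auto simp: bier_facet_def)
  note F = bier_facet[OF assms(1,3,5), folded 1] bier_facet[OF assms(1,2,4), folded 2]
  show ?thesis by (rule colour_apex_eq[OF F]) (use n False in auto)
qed simp

text \<open>The square of which K contains just the edge from I to \<open>insert a I\<close>: with x
  as the missing point in both facets, a is exchanged for a' over a common ridge.\<close>

lemma colour_eq_of_mixed:
  assumes "insert a I \<in> K" "insert x I \<notin> K" "x \<in> {1..m}" "a \<notin> I"
  shows "c (Inl a) = c (Inr a)"
proof -
  let ?R = "Inl ` I \<union> Inr ` ({1..m} - insert a (insert x I))"
  have I: "I \<in> K" using down assms by blast
  have n: "x \<notin> I" "a \<noteq> x" "a \<in> {1..m}" using assms I face_subset[OF assms(1)] by (auto simp: insert_absorb)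
  have nf: "insert x (insert a I) \<notin> K" using assms down by blast
  have 1: "insert (Inl a) ?R = bier_facet (insert a I) x" and 2: "insert (Inr a) ?R = bier_facet I x"
    using n assms by (auto simp: bier_facet_def)
  note F = bier_facet[OF assms(1) nf assms(3), folded 1] bier_facet[OF I assms(2,3), folded 2]
  show ?thesis by (rule colour_apex_eq[OF F]) (use assms n in auto)
qed

lemma colour_neq: "{p, q} \<in> bier m K \<Longrightarrow> p \<noteq> q \<Longrightarrow> c p \<noteq> c q"
  using colouring unfolding proper_colouring_def by blast

lemma colour_neq_Inl: "{a, x} \<in> K \<Longrightarrow> a \<noteq> x \<Longrightarrow> c (Inl a) \<noteq> c (Inl x)"
proof (rule colour_neq)
  assume "{a,x} \<in> K" "a \<noteq> x"
  moreover have "{i. i = a \<or> i = x} = {a,x}" by auto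
  ultimately show "{Inl a, Inl x} \<in> bier m K"
    using ground_not_face by (simp add: bier_iff alexander_dual_def)
qed auto

text \<open>The complement condition says that {a, x} lies in the Alexander dual. It holds as soon
  as the remaining points contain a non-face, which is how it is verified later.\<close>

lemma colour_neq_Inr:
  assumes "{1..m} - {a, x} \<notin> K" "a \<noteq> x" "a \<in> {1..m}" "x \<in> {1..m}"
  shows "c (Inr a) \<noteq> c (Inr x)"
proof (rule colour_neq)
  have "{i. i = a \<or> i = x} = {a,x}" by auto
  with assms show "{Inr a, Inr x} \<in> bier m K"
    using empty_face by (simp add: bier_iff alexander_dual_def)
qed (use assms in auto)

lemma colour_neq_mixed:
  assumes "{a} \<in> K" "{1..m} - {x} \<notin> K" "a \<noteq> x" "x \<in> {1..m}"
  shows "c (Inl a) \<noteq> c (Inr x)"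
  by (rule colour_neq) (use assms in \<open>auto simp add: bier_iff alexander_dual_def\<close>)

section \<open>Missing edges and the four shapes of K\<close>

definition missing_edge :: "nat \<Rightarrow> nat \<Rightarrow> bool" where
  "missing_edge u v \<longleftrightarrow> {u} \<in> K \<and> {v} \<in> K \<and> {u, v} \<notin> K"

lemma missing_edge_sym: "missing_edge u v \<Longrightarrow> missing_edge v u"
  unfolding missing_edge_def by (auto simp: insert_commute)

lemma missing_edge_neq: "missing_edge u v \<Longrightarrow> u \<noteq> v"
  unfolding missing_edge_def by auto

lemma missing_edge_ground: "missing_edge u v \<Longrightarrow> u \<in> {1..m}" "missing_edge u v \<Longrightarrow> v \<in> {1..m}"
  unfolding missing_edge_def using face_subset[of "{u}"] face_subset[of "{v}"] by auto

lemma missing_edge_colour: "missing_edge u v \<Longrightarrow> c (Inl u) = c (Inl v)"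
  using colour_eq_of_pair[of u "{}" v] unfolding missing_edge_def by auto

text \<open>Colours are constant along missing edges, whereas an edge of K would separate the
  colours of u and w. So being equal or non-adjacent is an equivalence relation on the vertices of
  K.\<close>

lemma missing_edge_trans:
  assumes "missing_edge u v" "missing_edge v w" "u \<noteq> w"
  shows "missing_edge u w"
  using missing_edge_colour[OF assms(1)] missing_edge_colour[OF assms(2)] colour_neq_Inl[of u w] assms
  unfolding missing_edge_def by auto

text \<open>If a minimal non-face N has two elements w and v, then N is the only corner outside K of
  the square over \<open>N - {w, v}\<close>. The resulting colour equality excludes the edge {w, v},
  so N contains a missing edge.\<close>

lemma nonface_cases:
  assumes "M \<subseteq> {1..m}" "M \<notin> K"
  shows "(\<exists>w\<in>M. {w} \<notin> K) \<or> (\<exists>u\<in>M. \<exists>v\<in>M. missing_edge u v)"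
proof -
  have "finite M" using assms finite_subset by blast
  then obtain N where N: "N \<subseteq> M" "N \<notin> K" "\<And>N'. N' \<subset> N \<Longrightarrow> N' \<in> K"
  proof -
    assume hyp: "\<And>N. N \<subseteq> M \<Longrightarrow> N \<notin> K \<Longrightarrow> (\<And>N'. N' \<subset> N \<Longrightarrow> N' \<in> K) \<Longrightarrow> thesis"
    let ?F = "{N. N \<subseteq> M \<and> N \<notin> K}"
    have "finite ?F" "M \<in> ?F" using \<open>finite M\<close> assms by simp_all
    from finite_has_minimal2[OF this] obtain N
      where N: "N \<in> ?F" "\<forall>N'\<in>?F. N' \<le> N \<longrightarrow> N = N'" by blast
    show ?thesis by (rule hyp[of N]) (use N in blast)+
  qed
  have "N \<noteq> {}" using N(2) empty_face by auto
  then obtain w where w: "w \<in> N" by blast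
  show ?thesis
  proof (cases "N = {w}")
    case True then show ?thesis using N by blast
  next
    case False
    then obtain v where v: "v \<in> N" "v \<noteq> w" using w by blast
    have "c (Inl w) = c (Inl v)"
    proof (rule colour_eq_of_pair[of w "N - {w,v}" v])
      show "insert w (N - {w,v}) \<in> K" "insert v (N - {w,v}) \<in> K"
        using v w by (auto intro!: N(3))
      have "insert w (insert v (N - {w, v})) = N" using v w by blast
      then show "insert w (insert v (N - {w, v})) \<notin> K" using N by simp
    qed auto
    then have "{w,v} \<notin> K" using colour_neq_Inl v by blast
    moreover have "{w} \<in> K" "{v} \<in> K" by (rule N(3), use v w in blast)+
    ultimately have "missing_edge w v" by (simp add: missing_edge_def)
    then show ?thesis using N v w by blast
  qed
qed

text \<open>A non-vertex w makes the complement of v a non-face, so u and v' are adjacent in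
  Bier(K). But the square over the empty face in the directions v and w gives v and v' the same
  colour, which is also the colour of u.\<close>

lemma missing_edge_imp_vertex:
  assumes uv: "missing_edge u v" and w: "w \<in> {1..m}"
  shows "{w} \<in> K"
proof (rule ccontr)
  assume nw: "{w} \<notin> K"
  have "c (Inl v) = c (Inr v)"
    using colour_eq_of_mixed[of v "{}" w] uv nw w by (auto simp: missing_edge_def)
  then have "c (Inl u) = c (Inr v)" using missing_edge_colour[OF uv] by simp
  moreover have "w \<noteq> v" using nw uv by (auto simp: missing_edge_def)
  then have "{1..m} - {v} \<notin> K" using down[of "{1..m}-{v}" "{w}"] nw w by auto
  ultimately show False
    using colour_neq_mixed[of u v] uv missing_edge_neq[OF uv] missing_edge_ground(2)[OF uv]
    by (auto simp: missing_edge_def)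
qed

text \<open>By transitivity either all four points are pairwise non-adjacent, or v and w are
  adjacent. In both cases {w, z} survives in the complement of the primed part and supplies the edge
  that contradicts a colour equality.\<close>

lemma missing_edges_intersect:
  assumes uv: "missing_edge u v" and wz: "missing_edge w z" and disj: "{u,v} \<inter> {w,z} = {}"
  shows False
proof -
  note g = missing_edge_ground[OF uv] missing_edge_ground[OF wz]
  have nwz: "A \<notin> K" if "{w,z} \<subseteq> A" for A using down wz that by (auto simp: missing_edge_def)
  show False
  proof (cases "missing_edge u w")
    case True
    \<comment> \<open>A maximal face through z avoids u and v, so u' and v' get the same
      colour.\<close>
    obtain I x where I: "{z} \<subseteq> I" "I \<in> K" "\<And>x. x \<in> {1..m} - I \<Longrightarrow> insert x I \<notin> K"
      using exists_crossing[of "{z}"] wz by (metis missing_edge_def)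
    have uz: "missing_edge u z" using missing_edge_trans[OF True wz] disj by auto
    have vz: "missing_edge v z" using missing_edge_trans[OF missing_edge_sym[OF uv] uz] disj by auto
    have "u \<notin> I" "v \<notin> I" using I(1) down[OF I(2), of "{u,z}"] down[OF I(2), of "{v,z}"] uz vz
      by (auto simp: missing_edge_def)
    then have "c (Inr u) = c (Inr v)" using colour_eq_of_copair[OF I(2), of u v] I(3) g by auto
    moreover have "{1..m} - {u,v} \<notin> K" by (rule nwz) (use disj g in auto)
    ultimately show False using colour_neq_Inr missing_edge_neq[OF uv] g by blast
  next
    case False
    have nvw: "\<not> missing_edge v w" using missing_edge_trans[OF uv] False disj by auto
    have "{v,w} \<in> K" using nvw uv wz by (auto simp: missing_edge_def)
    \<comment> \<open>The square over {w} in the directions v and z.\<close>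
    then have "c (Inl v) = c (Inr v)"
      using colour_eq_of_mixed[of v "{w}" z] disj g wz by (auto simp: missing_edge_def insert_commute)
    then have "c (Inl u) = c (Inr v)" using missing_edge_colour[OF uv] by simp
    moreover have "{1..m} - {v} \<notin> K" by (rule nwz) (use disj g in auto)
    ultimately show False
      using colour_neq_mixed[of u v] uv missing_edge_neq[OF uv] g by (auto simp: missing_edge_def)
  qed
qed

text \<open>If an edge is missing, all points are vertices and the faces are the sets without a
  missing edge inside. Missing edges pairwise meet and are transitive, which leaves a single one or
  a triangle. If none is missing, K is a full simplex on its vertices; with three non-vertices u, v,
  w, the vertices u' and v' would have equal colours and yet be adjacent, since w lies in the
  complement of {u, v}.\<close>

lemma balanced_cases:
  obtains (drop_one) u where "u \<in> {1..m}" "K = Pow ({1..m} - {u})"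
  | (drop_two) u v where "u \<in> {1..m}" "v \<in> {1..m}" "u \<noteq> v" "K = Pow ({1..m} - {u, v})"
  | (edge) u v where "u \<in> {1..m}" "v \<in> {1..m}" "u \<noteq> v"
      "K = {I. I \<subseteq> {1..m} \<and> \<not> {u, v} \<subseteq> I}"
  | (triangle) u v w where "u \<in> {1..m}" "v \<in> {1..m}" "w \<in> {1..m}" "distinct [u, v, w]"
      "K = {I. I \<subseteq> {1..m} \<and> (\<forall>x\<in>I \<inter> {u, v, w}. \<forall>y\<in>I \<inter> {u, v, w}. x = y)}"
proof (cases "\<exists>u v. missing_edge u v")
  case True
  then obtain u v where uv: "missing_edge u v" by blast
  have K: "I \<in> K \<longleftrightarrow> I \<subseteq> {1..m} \<and> (\<forall>x\<in>I. \<forall>y\<in>I. \<not> missing_edge x y)" for I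
  proof -
    have "I \<notin> K" if "x \<in> I" "y \<in> I" "missing_edge x y" for x y
      using that down[of I "{x,y}"] by (auto simp: missing_edge_def)
    moreover have "\<not> (\<exists>w\<in>I. {w} \<notin> K)" if "I \<subseteq> {1..m}" using missing_edge_imp_vertex[OF uv] that by blast
    ultimately show ?thesis using nonface_cases[of I] face_subset[of I] by blast
  qed
  show ?thesis
  proof (cases "\<forall>x y. missing_edge x y \<longrightarrow> {x,y} = {u,v}")
    case True
    have "missing_edge x y \<longleftrightarrow> {x,y} = {u,v}" for x y
      using True uv missing_edge_sym[OF uv] by (auto simp: doubleton_eq_iff)
    then have "I \<in> K \<longleftrightarrow> I \<subseteq> {1..m} \<and> \<not> {u, v} \<subseteq> I" for I unfolding K
      by (auto simp: doubleton_eq_iff)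
    then have "K = {I. I \<subseteq> {1..m} \<and> \<not> {u, v} \<subseteq> I}" by blast
    with missing_edge_ground[OF uv] missing_edge_neq[OF uv] show ?thesis by (rule edge)
  next
    case False
    then obtain x y where xy: "missing_edge x y" "{x,y} \<noteq> {u,v}" by blast
    then have "{x,y} \<inter> {u,v} \<noteq> {}" using missing_edges_intersect[OF xy(1) uv] by blast
    then have "x \<in> {u,v} \<or> y \<in> {u,v}" by blast
    moreover have "\<not> (x \<in> {u,v} \<and> y \<in> {u,v})"
      using xy(2) missing_edge_neq[OF xy(1)] by auto
    ultimately obtain t w where tw: "missing_edge t w" "t \<in> {u,v}" "w \<notin> {u,v}"
      using xy(1) missing_edge_sym[OF xy(1)] by blast
    have uw: "missing_edge u w" and vw: "missing_edge v w"
      using tw missing_edge_trans[OF uv, of w] missing_edge_trans[OF missing_edge_sym[OF uv], of w] by auto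
    note s = uv uw vw missing_edge_sym[OF uv] missing_edge_sym[OF uw] missing_edge_sym[OF vw]
    have "missing_edge x y \<longleftrightarrow> x \<noteq> y \<and> x \<in> {u,v,w} \<and> y \<in> {u,v,w}" for x y
    proof
      assume xy: "missing_edge x y"
      show "x \<noteq> y \<and> x \<in> {u,v,w} \<and> y \<in> {u,v,w}"
        using missing_edges_intersect[OF xy uv] missing_edges_intersect[OF xy uw]
          missing_edges_intersect[OF xy vw] missing_edge_neq[OF xy] missing_edge_neq[OF uv]
          missing_edge_neq[OF uw] missing_edge_neq[OF vw] by blast
    qed (use s in auto)
    then have "K = {I. I \<subseteq> {1..m} \<and> (\<forall>x\<in>I \<inter> {u, v, w}. \<forall>y\<in>I \<inter> {u, v, w}. x = y)}"
      unfolding set_eq_iff K by blast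
    moreover have "distinct [u,v,w]" using s missing_edge_neq by auto
    ultimately show ?thesis
      using triangle[OF missing_edge_ground[OF uv] missing_edge_ground(2)[OF uw]] by blast
  qed
next
  case False
  define S where "S = {w\<in>{1..m}. {w} \<in> K}"
  have "I \<in> K \<longleftrightarrow> I \<subseteq> S" for I
  proof
    assume "I \<in> K" then show "I \<subseteq> S" using face_subset down unfolding S_def by blast
  next
    assume "I \<subseteq> S" then show "I \<in> K" using nonface_cases[of I] False unfolding S_def by blast
  qed
  then have KS: "K = Pow S" by auto
  have "S \<noteq> {1..m}" using KS ground_not_face by auto
  then obtain u where u: "u \<in> {1..m}" "u \<notin> S" unfolding S_def by blast
  show ?thesis
  proof (cases "S = {1..m} - {u}")
    case True then show ?thesis using drop_one[OF u(1)] KS by simp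
  next
    case False
    then obtain v where v: "v \<in> {1..m}" "v \<notin> S" "v \<noteq> u" using u unfolding S_def by blast
    have "S = {1..m} - {u,v}"
    proof (rule ccontr)
      assume "S \<noteq> {1..m} - {u,v}"
      then obtain w where w: "w \<in> {1..m}" "w \<notin> S" "w \<noteq> u" "w \<noteq> v"
        using u v unfolding S_def by blast
      have "c (Inr u) = c (Inr v)" using colour_eq_of_copair[of S u v] u v KS by auto
      moreover have "{1..m} - {u,v} \<notin> K" using KS w by auto
      ultimately show False using colour_neq_Inr u v by blast
    qed
    then show ?thesis using drop_two[OF u(1) v(1)] v(3) KS by auto
  qed
qed

end

section \<open>Simplicial isomorphisms and the two model complexes\<close>

text \<open>With the vertex set V made explicit, it suffices to compare membership for subsets of V;
  surjectivity follows because every member of \<open>L2\<close> is the image of such a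
  subset.\<close>

lemma simp_isoI:
  assumes inj: "inj_on f V" and V: "\<And>X. X \<in> L1 \<Longrightarrow> X \<subseteq> V" "\<And>v. v \<in> V \<Longrightarrow> {v} \<in> L1"
    and L2: "\<And>Y. Y \<in> L2 \<Longrightarrow> Y \<subseteq> f ` V" and iff: "\<And>X. X \<subseteq> V \<Longrightarrow> X \<in> L1 \<longleftrightarrow> f ` X \<in> L2"
  shows "simp_iso L1 L2"
proof -
  have U1: "\<Union>L1 = V"
  proof
    show "\<Union>L1 \<subseteq> V" using V(1) by (rule Union_least)
    show "V \<subseteq> \<Union>L1" using V(2) by (intro subsetI UnionI[of "{_}"]) auto
  qed
  have im: "(image f) ` L1 = L2"
  proof
    show "(image f) ` L1 \<subseteq> L2"
    proof (rule image_subsetI)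
      fix X assume "X \<in> L1" then show "f ` X \<in> L2" using iff[OF V(1)] by simp
    qed
    show "L2 \<subseteq> (image f) ` L1"
    proof
      fix Y assume Y: "Y \<in> L2"
      then obtain X where "X \<subseteq> V" "Y = f ` X" using L2 by (meson subset_imageE)
      then show "Y \<in> (image f) ` L1" using iff[of X] Y by auto
    qed
  qed
  have "\<Union>L2 = f ` V" unfolding im[symmetric] U1[symmetric] by blast
  then have "bij_betw f (\<Union>L1) (\<Union>L2)" using inj U1 by (simp add: bij_betw_def)
  with im show ?thesis unfolding simp_iso_def by (intro exI[of _ f] conjI)
qed

lemma simp_isoE:
  assumes "simp_iso L1 L2"
  obtains f where "bij_betw f (\<Union>L1) (\<Union>L2)" "(image f) ` L1 = L2"
  using assms unfolding simp_iso_def by (elim exE conjE)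

lemma simp_iso_sym:
  assumes "simp_iso L1 L2"
  shows "simp_iso L2 L1"
proof -
  obtain f where f: "bij_betw f (\<Union>L1) (\<Union>L2)" "(image f) ` L1 = L2"
    using assms by (rule simp_isoE)
  let ?g = "inv_into (\<Union>L1) f"
  have "?g ` f ` X = X" if "X \<in> L1" for X
    by (rule inv_into_image_cancel) (use f(1) that in \<open>simp_all add: bij_betw_def Union_upper\<close>)
  then have "(image ?g) ` L2 = L1" unfolding f(2)[symmetric] image_image by simp
  with bij_betw_inv_into[OF f(1)] show ?thesis
    unfolding simp_iso_def by (intro exI[of _ ?g] conjI)
qed

lemma simp_iso_trans:
  assumes "simp_iso L1 L2" "simp_iso L2 L3"
  shows "simp_iso L1 L3"
proof -
  obtain f where f: "bij_betw f (\<Union>L1) (\<Union>L2)" "(image f) ` L1 = L2"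
    using assms(1) by (rule simp_isoE)
  obtain g where g: "bij_betw g (\<Union>L2) (\<Union>L3)" "(image g) ` L2 = L3"
    using assms(2) by (rule simp_isoE)
  have "(image (g \<circ> f)) ` L1 = L3"
    unfolding g(2)[symmetric] f(2)[symmetric] by (simp add: image_comp image_image)
  with bij_betw_trans[OF f(1) g(1)] show ?thesis
    unfolding simp_iso_def by (intro exI[of _ "g \<circ> f"] conjI)
qed

lemma simp_iso_proper_colouring:
  assumes "simp_iso L1 L2" "proper_colouring L1 k c"
  shows "\<exists>c'. proper_colouring L2 k c'"
proof -
  obtain g where g': "bij_betw g (\<Union>L2) (\<Union>L1)" and g: "(image g) ` L2 = L1"
    using simp_iso_sym[OF assms(1)] by (rule simp_isoE)
  note inj = bij_betw_imp_inj_on[OF g']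
  have "proper_colouring L2 k (c \<circ> g)"
    unfolding proper_colouring_def
  proof (intro conjI ballI allI impI)
    fix v assume "v \<in> vertices L2"
    then have "g ` {v} \<in> L1" unfolding g[symmetric] vertices_def by (intro imageI) simp
    then show "(c \<circ> g) v < k" using assms(2) by (auto simp: vertices_def proper_colouring_def)
  next
    fix u v assume uv: "{u,v} \<in> L2 \<and> u \<noteq> v"
    then have "g ` {u,v} \<in> L1" unfolding g[symmetric] by (intro imageI) simp
    moreover have "u \<in> \<Union>L2" "v \<in> \<Union>L2" using uv by blast+
    then have "g u \<noteq> g v" using inj_onD[OF inj] uv by blast
    ultimately show "(c \<circ> g) u \<noteq> (c \<circ> g) v"
      using assms(2) by (simp add: proper_colouring_def)
  qed
  then show ?thesis by (intro exI[of _ "c \<circ> g"])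
qed

text \<open>A vertex \<open>(i, s)\<close> is one of two opposite vertices indexed by \<open>i\<close>. With \<open>T = {}\<close> the
  complex below is the boundary of a cross-polytope; the three pairs indexed by a set \<open>T\<close> of
  three elements span a hexagon in which \<open>(i, s)\<close> and \<open>(j, \<not> s)\<close> are adjacent for \<open>i \<noteq> j\<close>.\<close>
definition conflict :: "'i set \<Rightarrow> 'i \<times> bool \<Rightarrow> 'i \<times> bool \<Rightarrow> bool" where
  "conflict T v w \<longleftrightarrow> (fst v = fst w \<and> snd v \<noteq> snd w) \<or>
     (fst v \<noteq> fst w \<and> snd v = snd w \<and> fst v \<in> T \<and> fst w \<in> T)"

definition conflict_free :: "'i set \<Rightarrow> 'i set \<Rightarrow> ('i \<times> bool) set set" where
  "conflict_free D T = {X. X \<subseteq> D \<times> UNIV \<and> (\<forall>v\<in>X. \<forall>w\<in>X. \<not> conflict T v w)}"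

lemma conflict_free_iff:
  "X \<in> conflict_free D T \<longleftrightarrow> X \<subseteq> D \<times> UNIV \<and> (\<forall>i. \<not> ((i, True) \<in> X \<and> (i, False) \<in> X)) \<and>
     (\<forall>s. \<forall>i\<in>T. \<forall>j\<in>T. (i, s) \<in> X \<and> (j, s) \<in> X \<longrightarrow> i = j)"
    (is "_ \<longleftrightarrow> _ \<and> ?opp \<and> ?hex")
proof -
  have "(\<forall>v\<in>X. \<forall>w\<in>X. \<not> conflict T v w) \<longleftrightarrow> ?opp \<and> ?hex"
  proof (intro iffI conjI allI ballI impI notI)
    fix i assume "\<forall>v\<in>X. \<forall>w\<in>X. \<not> conflict T v w" and i: "(i, True) \<in> X \<and> (i, False) \<in> X"
    then have "\<not> conflict T (i, True) (i, False)" by simp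
    then show False by (simp add: conflict_def)
  next
    fix s i j assume "\<forall>v\<in>X. \<forall>w\<in>X. \<not> conflict T v w" and ij: "i \<in> T" "j \<in> T" "(i, s) \<in> X \<and> (j, s) \<in> X"
    then have "\<not> conflict T (i, s) (j, s)" by simp
    then show "i = j" using ij by (simp add: conflict_def)
  next
    fix v w assume oh: "?opp \<and> ?hex" and vw: "v \<in> X" "w \<in> X" "conflict T v w"
    obtain i s where v: "v = (i, s)" by (rule prod.exhaust)
    obtain j t where w: "w = (j, t)" by (rule prod.exhaust)
    consider "i = j" "s \<noteq> t" | "i \<noteq> j" "s = t" "i \<in> T" "j \<in> T"
      using vw(3) unfolding conflict_def v w by auto
    then show False
    proof cases
      case 1
      then have "(i, True) \<in> X \<and> (i, False) \<in> X" using vw(1,2) v w by (cases s; cases t) simp_all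
      with conjunct1[OF oh] show False by metis
    next
      case 2
      then show False using oh vw(1,2) unfolding v w by metis
    qed
  qed
  then show ?thesis unfolding conflict_free_def by simp
qed

lemma conflict_free_singleton: "v \<in> D \<times> UNIV \<Longrightarrow> {v} \<in> conflict_free D T"
  by (auto simp: conflict_free_def conflict_def)

lemma subset_Inl_Inr_iff:
  "X \<subseteq> Inl ` A \<union> Inr ` B \<longleftrightarrow> {i. Inl i \<in> X} \<subseteq> A \<and> {i. Inr i \<in> X} \<subseteq> B"
proof
  assume r: "{i. Inl i \<in> X} \<subseteq> A \<and> {i. Inr i \<in> X} \<subseteq> B"
  show "X \<subseteq> Inl ` A \<union> Inr ` B"
  proof
    fix z assume "z \<in> X" then show "z \<in> Inl ` A \<union> Inr ` B" using r by (cases z) auto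
  qed
qed auto

section \<open>The four shapes of K and the model complexes\<close>

lemma bij_betw_ground_minus:
  assumes "CARD('n::finite) = m - 1" "u \<in> {1..m::nat}"
  obtains e where "bij_betw e (UNIV :: 'n set) ({1..m} - {u})"
proof -
  have "card (UNIV :: 'n set) = card ({1..m} - {u})" using assms by simp
  then show ?thesis using that finite_same_card_bij[of "UNIV :: 'n set" "{1..m} - {u}"] by auto
qed

text \<open>The common part of three shapes of K: the vertices of Bier(K) fall into m - 1 pairs
  \<open>g i True\<close>, \<open>g i False\<close>, and the faces are the vertex sets containing no
  pair. Dropping u leaves as many indices as \<open>'n\<close> has elements.\<close>

lemma cross_polytope_iso_bier:
  fixes g :: "nat \<Rightarrow> bool \<Rightarrow> nat + nat"
  assumes n: "CARD('n::finite) = m - 1" and u: "u \<in> {1..m}"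
    and inj: "inj_on (\<lambda>(i, s). g i s) (({1..m} - {u}) \<times> UNIV)"
    and bier: "\<And>X. X \<in> bier m K \<longleftrightarrow> X \<subseteq> (\<lambda>(i, s). g i s) ` (({1..m} - {u}) \<times> UNIV) \<and>
      (\<forall>i\<in>{1..m} - {u}. \<not> (g i True \<in> X \<and> g i False \<in> X))"
  shows "simp_iso (conflict_free (range Some :: 'n option set) {}) (bier m K)"
proof -
  obtain e where e: "bij_betw e (UNIV :: 'n set) ({1..m} - {u})"
    using bij_betw_ground_minus[OF n u] .
  define f where "f = (\<lambda>(i, s). g (e (the i)) s)"
  have e1: "inj e" and e2: "range e = {1..m} - {u}" using e by (auto simp: bij_betw_def)
  have inj': "inj_on f (range Some \<times> UNIV)"
  proof (rule inj_onI)
    fix x y assume x: "x \<in> range Some \<times> UNIV" and y: "y \<in> range Some \<times> UNIV" and xy: "f x = f y"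
    obtain i s j t where e': "x = (Some i,s)" "y = (Some j,t)" using x y by auto
    have "e i \<in> {1..m} - {u}" "e j \<in> {1..m} - {u}" using e2 by blast+
    then have "(e i, s) = (e j, t)"
      by (intro inj_onD[OF inj]) (use xy in \<open>auto simp: f_def e'\<close>)
    then show "x = y" using e' e1 by (auto dest: injD)
  qed
  have im: "f ` (range Some \<times> UNIV) = (\<lambda>(i, s). g i s) ` (({1..m} - {u}) \<times> UNIV)"
    unfolding e2[symmetric] f_def by force
  show ?thesis
  proof (rule simp_isoI[OF inj'])
    fix X :: "('n option \<times> bool) set" assume X: "X \<subseteq> range Some \<times> UNIV"
    have mem: "g (e i) s \<in> f ` X \<longleftrightarrow> (Some i, s) \<in> X" for i s
    proof -
      have "f (Some i, s) \<in> f ` X \<longleftrightarrow> (Some i, s) \<in> X"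
        by (rule inj_on_image_mem_iff[OF inj' _ X]) auto
      then show ?thesis by (simp add: f_def)
    qed
    have "(\<forall>i\<in>{1..m} - {u}. \<not> (g i True \<in> f ` X \<and> g i False \<in> f ` X)) \<longleftrightarrow>
        (\<forall>i. \<not> ((Some i, True) \<in> X \<and> (Some i, False) \<in> X))"
      unfolding e2[symmetric] by (simp add: mem)
    also have "\<dots> \<longleftrightarrow> (\<forall>i. \<not> ((i, True) \<in> X \<and> (i, False) \<in> X))"
      using X by blast
    finally show "X \<in> conflict_free (range Some) {} \<longleftrightarrow> f ` X \<in> bier m K"
      unfolding bier conflict_free_iff im[symmetric] using X by auto
  next
    fix Y assume "Y \<in> bier m K" then show "Y \<subseteq> f ` (range Some \<times> UNIV)"
      unfolding bier im by blast
  qed (auto simp: conflict_free_iff)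
qed

text \<open>K is its own dual; the pairs are i, i', and neither u nor u' is a vertex.\<close>

lemma cross_polytope_iso_bier_drop_one:
  assumes n: "CARD('n::finite) = m - 1" and u: "u \<in> {1..m}" and K: "K = Pow ({1..m} - {u})"
  shows "simp_iso (conflict_free (range Some :: 'n option set) {}) (bier m K)"
proof (rule cross_polytope_iso_bier[OF n u])
  let ?g = "\<lambda>(i::nat) s. if s then Inl i else Inr i :: nat + nat"
  show "inj_on (\<lambda>(i, s). ?g i s) (({1..m} - {u}) \<times> UNIV)"
    by (auto simp: inj_on_def split: if_splits)
  fix X
  have im: "(\<lambda>(i, s). ?g i s) ` (({1..m} - {u}) \<times> UNIV) = Inl ` ({1..m} - {u}) \<union> Inr ` ({1..m} - {u})"
  proof
    show "Inl ` ({1..m} - {u}) \<union> Inr ` ({1..m} - {u}) \<subseteq> (\<lambda>(i, s). ?g i s) ` (({1..m} - {u}) \<times> UNIV)"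
    proof
      fix z :: "nat + nat" assume z: "z \<in> Inl ` ({1..m} - {u}) \<union> Inr ` ({1..m} - {u})"
      show "z \<in> (\<lambda>(i, s). ?g i s) ` (({1..m} - {u}) \<times> UNIV)"
      proof (cases z)
        case (Inl i)
        then show ?thesis using z by (intro image_eqI[of _ _ "(i,True)"]) auto
      next
        case (Inr i)
        then show ?thesis using z by (intro image_eqI[of _ _ "(i,False)"]) auto
      qed
    qed
  qed (auto split: if_splits)
  have dual: "J \<in> alexander_dual m K \<longleftrightarrow> J \<subseteq> {1..m} - {u}" for J
    unfolding K alexander_dual_def using u by auto
  show "X \<in> bier m K \<longleftrightarrow> X \<subseteq> (\<lambda>(i, s). ?g i s) ` (({1..m} - {u}) \<times> UNIV) \<and>
      (\<forall>i\<in>{1..m} - {u}. \<not> (?g i True \<in> X \<and> ?g i False \<in> X))"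
    unfolding im subset_Inl_Inr_iff bier_iff dual unfolding K by auto
qed

text \<open>The points u and v are no vertices, but u' and v' are. A dual face may not contain both,
  so they form a pair, which receives the index v; the other pairs are i, i'.\<close>

lemma cross_polytope_iso_bier_drop_two:
  assumes n: "CARD('n::finite) = m - 1" and u: "u \<in> {1..m}" and v: "v \<in> {1..m}" "u \<noteq> v"
    and K: "K = Pow ({1..m} - {u, v})"
  shows "simp_iso (conflict_free (range Some :: 'n option set) {}) (bier m K)"
proof (rule cross_polytope_iso_bier[OF n u])
  let ?g = "\<lambda>(i::nat) s. if i = v then (if s then Inr u else Inr v) else if s then Inl i else Inr i :: nat + nat"
  show "inj_on (\<lambda>(i, s). ?g i s) (({1..m} - {u}) \<times> UNIV)"
    using v by (auto simp: inj_on_def split: if_splits)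
  fix X
  have im: "(\<lambda>(i, s). ?g i s) ` (({1..m} - {u}) \<times> UNIV) = Inl ` ({1..m} - {u,v}) \<union> Inr ` {1..m}"
  proof
    show "Inl ` ({1..m} - {u,v}) \<union> Inr ` {1..m} \<subseteq> (\<lambda>(i, s). ?g i s) ` (({1..m} - {u}) \<times> UNIV)"
    proof
      fix z assume z: "z \<in> Inl ` ({1..m} - {u,v}) \<union> Inr ` {1..m}"
      show "z \<in> (\<lambda>(i, s). ?g i s) ` (({1..m} - {u}) \<times> UNIV)"
      proof (cases z)
        case (Inl i)
        then show ?thesis using z by (intro image_eqI[of _ _ "(i,True)"]) auto
      next
        case (Inr i)
        \<comment> \<open>The vertex u' has no index of its own and is the positive member of the
          pair of v.\<close>
        then show ?thesis using z v
          by (intro image_eqI[of _ _ "if i = u then (v,True) else (i,False)"]) auto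
      qed
    qed
  qed (use u v in \<open>auto split: if_splits\<close>)
  have dual: "J \<in> alexander_dual m K \<longleftrightarrow> J \<subseteq> {1..m} \<and> \<not> (u \<in> J \<and> v \<in> J)" for J
    unfolding K alexander_dual_def using u v by auto
  have pairs: "(\<forall>i\<in>{1..m} - {u}. \<not> (?g i True \<in> X \<and> ?g i False \<in> X)) \<longleftrightarrow>
      \<not> (Inr u \<in> X \<and> Inr v \<in> X) \<and> (\<forall>i\<in>{1..m} - {u, v}. \<not> (Inl i \<in> X \<and> Inr i \<in> X))"
    using v by auto
  show "X \<in> bier m K \<longleftrightarrow> X \<subseteq> (\<lambda>(i, s). ?g i s) ` (({1..m} - {u}) \<times> UNIV) \<and>
      (\<forall>i\<in>{1..m} - {u}. \<not> (?g i True \<in> X \<and> ?g i False \<in> X))"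
    unfolding pairs unfolding im subset_Inl_Inr_iff bier_iff dual unfolding K by auto
qed

text \<open>Alexander dual to the preceding shape, so primed and unprimed vertices exchange roles:
  the pair indexed by v now consists of u and v.\<close>

lemma cross_polytope_iso_bier_edge:
  assumes n: "CARD('n::finite) = m - 1" and u: "u \<in> {1..m}" and v: "v \<in> {1..m}" "u \<noteq> v"
    and K: "K = {I. I \<subseteq> {1..m} \<and> \<not> {u, v} \<subseteq> I}"
  shows "simp_iso (conflict_free (range Some :: 'n option set) {}) (bier m K)"
proof (rule cross_polytope_iso_bier[OF n u])
  let ?g = "\<lambda>(i::nat) s. if i = v then (if s then Inl u else Inl v) else if s then Inl i else Inr i :: nat + nat"
  show "inj_on (\<lambda>(i, s). ?g i s) (({1..m} - {u}) \<times> UNIV)"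
    using v by (auto simp: inj_on_def split: if_splits)
  fix X
  have im: "(\<lambda>(i, s). ?g i s) ` (({1..m} - {u}) \<times> UNIV) = Inl ` {1..m} \<union> Inr ` ({1..m} - {u,v})"
  proof
    show "Inl ` {1..m} \<union> Inr ` ({1..m} - {u,v}) \<subseteq> (\<lambda>(i, s). ?g i s) ` (({1..m} - {u}) \<times> UNIV)"
    proof
      fix z assume z: "z \<in> Inl ` {1..m} \<union> Inr ` ({1..m} - {u,v})"
      show "z \<in> (\<lambda>(i, s). ?g i s) ` (({1..m} - {u}) \<times> UNIV)"
      proof (cases z)
        case (Inl i)
        then show ?thesis using z v
          by (intro image_eqI[of _ _ "if i = u then (v,True) else (i, i \<noteq> v)"]) auto
      next
        case (Inr i)
        then show ?thesis using z by (intro image_eqI[of _ _ "(i,False)"]) auto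
      qed
    qed
  qed (use u v in \<open>auto split: if_splits\<close>)
  have dual: "J \<in> alexander_dual m K \<longleftrightarrow> J \<subseteq> {1..m} - {u, v}" for J
    unfolding K alexander_dual_def using u v by auto
  have pairs: "(\<forall>i\<in>{1..m} - {u}. \<not> (?g i True \<in> X \<and> ?g i False \<in> X)) \<longleftrightarrow>
      \<not> (Inl u \<in> X \<and> Inl v \<in> X) \<and> (\<forall>i\<in>{1..m} - {u, v}. \<not> (Inl i \<in> X \<and> Inr i \<in> X))"
    using v by auto
  show "X \<in> bier m K \<longleftrightarrow> X \<subseteq> (\<lambda>(i, s). ?g i s) ` (({1..m} - {u}) \<times> UNIV) \<and>
      (\<forall>i\<in>{1..m} - {u}. \<not> (?g i True \<in> X \<and> ?g i False \<in> X))"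
    unfolding pairs unfolding im subset_Inl_Inr_iff bier_iff dual unfolding K by auto
qed

lemma ball_Int_Collect_unique_iff:
  "(\<forall>x\<in>{i. P i} \<inter> T. \<forall>y\<in>{i. P i} \<inter> T. x = y) \<longleftrightarrow> (\<forall>i\<in>T. \<forall>j\<in>T. P i \<and> P j \<longrightarrow> i = j)"
  by auto

lemma conj_rotate: "((P \<and> Q) \<and> R) = ((Q \<and> R) \<and> P)"
  by auto

text \<open>K is its own dual, because exactly one of a set and its complement contains two of the
  three points u, v, w. So a face has at most one of them in each copy, which is the relation
  \<open>conflict\<close> with sign True for unprimed vertices. The hexagon is u, v', w, u', v,
  w'.\<close>

lemma hexagon_join_iso_bier:
  assumes n: "CARD('n::finite) = m - 1" and u: "u \<in> {1..m}" and v: "v \<in> {1..m}"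
    and w: "w \<in> {1..m}" and dist: "distinct [u, v, w]"
    and K: "K = {I. I \<subseteq> {1..m} \<and> (\<forall>x\<in>I \<inter> {u, v, w}. \<forall>y\<in>I \<inter> {u, v, w}. x = y)}"
  shows "\<exists>a b :: 'n. a \<noteq> b \<and> simp_iso (conflict_free UNIV {None, Some a, Some b}) (bier m K)"
proof -
  obtain e0 where e0: "bij_betw e0 (UNIV :: 'n set) ({1..m} - {u})"
    using bij_betw_ground_minus[OF n u] .
  \<comment> \<open>\<open>None\<close> takes the point u left out by \<open>e0\<close>, which gives
    a bijection from \<open>'n option\<close> onto the ground set.\<close>
  define e where "e = case_option u e0"
  have e0': "inj e0" "range e0 = {1..m} - {u}" using e0 by (auto simp: bij_betw_def)
  have inj: "inj e"
  proof (rule injI)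
    fix x y assume "e x = e y"
    moreover have "e0 i \<noteq> u" for i
    proof -
      have "e0 i \<in> range e0" by simp
      then show ?thesis unfolding e0'(2) by simp
    qed
    ultimately show "x = y"
      using e0'(1) by (cases x; cases y) (simp_all add: e_def inj_eq eq_commute[of u])
  qed
  have range: "range e = {1..m}"
  proof -
    have "range e = insert (e None) (range e0)" unfolding UNIV_option_conv e_def by (simp add: image_image)
    then show ?thesis using e0'(2) u by (auto simp: e_def)
  qed
  have "v \<in> range e0" "w \<in> range e0" using e0'(2) v w dist by auto
  then obtain a b where ab: "e0 a = v" "e0 b = w" by (elim rangeE) simp
  let ?T = "{None, Some a, Some b}"
  have "a \<noteq> b" using ab dist by auto
  have T: "{u,v,w} = e ` ?T" by (simp add: e_def ab)
  have memK: "e ` A \<in> K \<longleftrightarrow> (\<forall>x\<in>A \<inter> ?T. \<forall>y\<in>A \<inter> ?T. x = y)" for A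
  proof -
    have 1: "e ` A \<inter> {u,v,w} = e ` (A \<inter> ?T)" unfolding T using inj by (simp add: image_Int)
    have 2: "e ` A \<subseteq> {1..m}" using range by auto
    have "(\<forall>x\<in>e ` (A \<inter> ?T). \<forall>y\<in>e ` (A \<inter> ?T). x = y) \<longleftrightarrow> (\<forall>x\<in>A \<inter> ?T. \<forall>y\<in>A \<inter> ?T. x = y)"
      unfolding ball_simps(9) inj_eq[OF inj] ..
    then show ?thesis unfolding K mem_Collect_eq 1 using 2 by simp
  qed
  have memD: "e ` A \<in> alexander_dual m K \<longleftrightarrow> (\<forall>x\<in>A \<inter> ?T. \<forall>y\<in>A \<inter> ?T. x = y)" for A
  proof -
    have 1: "{1..m} - e ` A = e ` (- A)" unfolding range[symmetric]
      by (metis Compl_eq_Diff_UNIV image_set_diff inj)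
    have 2: "e ` A \<subseteq> {1..m}" using range by auto
    have 3: "Some a \<noteq> Some b" using \<open>a \<noteq> b\<close> by simp
    have "(\<forall>x\<in>-A \<inter> ?T. \<forall>y\<in>-A \<inter> ?T. x = y) \<longleftrightarrow> \<not> (\<forall>x\<in>A \<inter> ?T. \<forall>y\<in>A \<inter> ?T. x = y)"
      using 3
      by (cases "None \<in> A"; cases "Some a \<in> A"; cases "Some b \<in> A"; simp add: Int_insert_right)
    then show ?thesis unfolding alexander_dual_def mem_Collect_eq 1 memK using 2 by simp
  qed
  define f where "f = (\<lambda>(i, s). if s then Inl (e i) else Inr (e i) :: nat + nat)"
  have "inj_on f (UNIV \<times> UNIV)"
    using inj by (auto simp: f_def inj_on_def split: if_splits)
  then have "simp_iso (conflict_free UNIV ?T) (bier m K)"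
  proof (rule simp_isoI)
    fix X :: "('n option \<times> bool) set"
    have "Inl z \<in> f ` X \<longleftrightarrow> z \<in> e ` {i. (i, True) \<in> X}"
      "Inr z \<in> f ` X \<longleftrightarrow> z \<in> e ` {i. (i, False) \<in> X}" for z
      unfolding image_iff Bex_def f_def by (auto split: if_splits)
    then have L: "{i. Inl i \<in> f ` X} = e ` {i. (i, True) \<in> X}"
      and R: "{i. Inr i \<in> f ` X} = e ` {i. (i, False) \<in> X}"
      by (simp_all add: set_eq_iff)
    have "(\<forall>i. \<not> (Inl i \<in> f ` X \<and> Inr i \<in> f ` X)) \<longleftrightarrow> {i. Inl i \<in> f ` X} \<inter> {i. Inr i \<in> f ` X} = {}"
      by (simp add: disjoint_iff)
    also have "\<dots> \<longleftrightarrow> (\<forall>i. \<not> ((i, True) \<in> X \<and> (i, False) \<in> X))"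
      unfolding L R image_Int[OF inj, symmetric] image_is_empty by (simp add: disjoint_iff)
    finally have disj: "(\<forall>i. \<not> (Inl i \<in> f ` X \<and> Inr i \<in> f ` X)) \<longleftrightarrow>
        (\<forall>i. \<not> ((i, True) \<in> X \<and> (i, False) \<in> X))" .
    let ?H = "\<lambda>s. \<forall>i\<in>?T. \<forall>j\<in>?T. (i, s) \<in> X \<and> (j, s) \<in> X \<longrightarrow> i = j"
      and ?O = "\<forall>i. \<not> ((i, True) \<in> X \<and> (i, False) \<in> X)"
    have bier: "f ` X \<in> bier m K \<longleftrightarrow> ?H True \<and> ?H False \<and> ?O"
      by (simp only: bier_iff disj L R memK memD ball_Int_Collect_unique_iff)
    have model: "X \<in> conflict_free UNIV ?T \<longleftrightarrow> ?O \<and> ?H True \<and> ?H False"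
      by (simp only: conflict_free_iff all_bool_eq UNIV_Times_UNIV subset_UNIV simp_thms)
    show "X \<in> conflict_free UNIV ?T \<longleftrightarrow> f ` X \<in> bier m K"
      unfolding bier model conj_assoc[symmetric] by (rule conj_rotate)
  next
    fix Y assume "Y \<in> bier m K"
    then have "{i. Inl i \<in> Y} \<in> K" "{i. Inr i \<in> Y} \<in> alexander_dual m K"
      unfolding bier_iff by - (elim conjE, assumption)+
    then have "{i. Inl i \<in> Y} \<subseteq> range e" "{i. Inr i \<in> Y} \<subseteq> range e"
      unfolding range K alexander_dual_def mem_Collect_eq by - (elim conjE, assumption)+
    then have "Y \<subseteq> Inl ` range e \<union> Inr ` range e" by (simp add: subset_Inl_Inr_iff)
    also have "\<dots> \<subseteq> f ` (UNIV \<times> UNIV)"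
    proof -
      have "Inl (e i) = f (i,True)" "Inr (e i) = f (i,False)" for i by (simp_all add: f_def)
      then show ?thesis by auto
    qed
    finally show "Y \<subseteq> f ` (UNIV \<times> UNIV)" .
  qed (auto simp: conflict_free_singleton)
  with \<open>a \<noteq> b\<close> show ?thesis by (intro exI conjI)
qed

lemma (in balanced_bier) bier_iso:
  assumes n: "CARD('n::finite) = m - 1"
  shows "simp_iso (conflict_free (range Some :: 'n option set) {}) (bier m K) \<or>
    m \<ge> 3 \<and> (\<exists>a b :: 'n. a \<noteq> b \<and> simp_iso (conflict_free UNIV {None, Some a, Some b}) (bier m K))"
proof (rule balanced_cases)
  fix u v w assume *: "u \<in> {1..m}" "v \<in> {1..m}" "w \<in> {1..m}" "distinct [u, v, w]"
    "K = {I. I \<subseteq> {1..m} \<and> (\<forall>x\<in>I \<inter> {u, v, w}. \<forall>y\<in>I \<inter> {u, v, w}. x = y)}"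
  have "card {u,v,w} \<le> card {1..m}" using * by (intro card_mono) auto
  then have "m \<ge> 3" using *(4) by simp
  with hexagon_join_iso_bier[OF n *] show ?thesis by (intro disjI2 conjI)
next
  fix u assume "u \<in> {1..m}" "K = Pow ({1..m} - {u})"
  from cross_polytope_iso_bier_drop_one[OF n this] show ?thesis ..
next
  fix u v assume "u \<in> {1..m}" "v \<in> {1..m}" "u \<noteq> v" "K = Pow ({1..m} - {u, v})"
  from cross_polytope_iso_bier_drop_two[OF n this] show ?thesis ..
next
  fix u v assume "u \<in> {1..m}" "v \<in> {1..m}" "u \<noteq> v" "K = {I. I \<subseteq> {1..m} \<and> \<not> {u, v} \<subseteq> I}"
  from cross_polytope_iso_bier_edge[OF n this] show ?thesis ..
qed

section \<open>Polytopes given by irredundant inequalities\<close>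

text \<open>A face containing, for each inequality, a point at which it is strict also contains the average
  of these points, which is interior.\<close>
lemma proper_face_subset_supporting:
  fixes \<alpha> :: "'v \<Rightarrow> 'a::euclidean_space"
  assumes V: "finite V" "V \<noteq> {}" and S: "S = {x. \<forall>v\<in>V. \<alpha> v \<bullet> x \<le> \<beta> v}"
    and F: "F face_of S" "F \<noteq> S"
  obtains v where "v \<in> V" "F \<subseteq> {x. \<alpha> v \<bullet> x = \<beta> v}"
proof (rule ccontr)
  note concl = that
  assume nt: "\<not> thesis"
  have no: "\<not> F \<subseteq> {x. \<alpha> v \<bullet> x = \<beta> v}" if v: "v \<in> V" for v
  proof
    assume "F \<subseteq> {x. \<alpha> v \<bullet> x = \<beta> v}"
    with v have thesis by (rule concl)
    with nt show False by contradiction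
  qed
  have FS: "F \<subseteq> S" using F(1) by (rule face_of_imp_subset)
  have cF: "convex F" using F(1) by (rule face_of_imp_convex)
  have ex: "\<exists>x\<in>F. \<alpha> v \<bullet> x < \<beta> v" if v: "v \<in> V" for v
  proof -
    obtain x where x: "x \<in> F" "\<alpha> v \<bullet> x \<noteq> \<beta> v" using no[OF v] by auto
    then have "\<alpha> v \<bullet> x \<le> \<beta> v" using FS v unfolding S by auto
    then show ?thesis using x by (intro bexI[of _ x]) auto
  qed
  have "\<exists>y\<in>F. \<forall>v\<in>W. \<alpha> v \<bullet> y < \<beta> v" if "finite W" "W \<subseteq> V" for W
    using that
  proof (induction W rule: finite_induct)
    case empty
    then show ?case using ex V(2) by auto
  next
    case (insert w W)
    then obtain y where y: "y \<in> F" "\<forall>v\<in>W. \<alpha> v \<bullet> y < \<beta> v" by auto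
    obtain x where x: "x \<in> F" "\<alpha> w \<bullet> x < \<beta> w" using ex[of w] insert.prems by auto
    let ?z = "(1/2) *\<^sub>R x + (1/2) *\<^sub>R y"
    have "?z \<in> F" by (rule convexD[OF cF x(1) y(1)]) auto
    moreover have "\<alpha> v \<bullet> ?z < \<beta> v" if v: "v \<in> insert w W" for v
    proof -
      have "\<alpha> v \<bullet> x \<le> \<beta> v" "\<alpha> v \<bullet> y \<le> \<beta> v"
        using x(1) y(1) FS v insert.prems unfolding S by auto
      moreover have "\<alpha> v \<bullet> x < \<beta> v \<or> \<alpha> v \<bullet> y < \<beta> v" using v x(2) y(2) by auto
      ultimately show ?thesis by (auto simp: inner_add_right)
    qed
    ultimately show ?case by (intro bexI[of _ ?z]) auto
  qed
  from this[OF V(1) subset_refl] obtain y where y: "y \<in> F" "\<forall>v\<in>V. \<alpha> v \<bullet> y < \<beta> v" by auto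
  have "open (\<Inter>v\<in>V. {x. \<alpha> v \<bullet> x < \<beta> v})" using V(1) by (intro open_INT) (auto intro: open_halfspace_lt)
  moreover have "(\<Inter>v\<in>V. {x. \<alpha> v \<bullet> x < \<beta> v}) \<subseteq> S" unfolding S by (auto intro: less_imp_le)
  ultimately have "(\<Inter>v\<in>V. {x. \<alpha> v \<bullet> x < \<beta> v}) \<subseteq> interior S" by (rule interior_maximal[rotated])
  then have "y \<in> F \<inter> interior S" using y by auto
  then show False using face_of_disjoint_interior[OF F] by simp
qed

text \<open>Otherwise the dimension of G would lie strictly between those of F and S, which differ
  by one.\<close>

lemma facet_maximal:
  fixes S :: "'a::euclidean_space set"
  assumes "convex S" "F facet_of S" "G face_of S" "G \<noteq> S" "F \<subseteq> G"
  shows "F = G"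
proof (rule ccontr)
  assume "F \<noteq> G"
  have "F face_of G"
    by (rule face_of_subset[OF facet_of_imp_face_of[OF assms(2)] assms(5) face_of_imp_subset[OF assms(3)]])
  then have "aff_dim F < aff_dim G"
    using face_of_aff_dim_lt[OF face_of_imp_convex[OF assms(3)]] \<open>F \<noteq> G\<close> by simp
  moreover have "aff_dim G < aff_dim S" by (rule face_of_aff_dim_lt[OF assms(1,3,4)])
  ultimately show False using assms(2) unfolding facet_of_def by simp
qed

lemma facet_ne: "F facet_of S \<Longrightarrow> F \<noteq> S"
  unfolding facet_of_def by auto

text \<open>\<open>strict\<close> provides an interior point and thus full dimension;
  \<open>nonempty\<close> and \<open>irredundant\<close>, which says that no side is contained in
  another, make inequalities and facets correspond bijectively.\<close>

locale irredundant_polytope =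
  fixes V :: "'v set" and \<alpha> :: "'v \<Rightarrow> 'a::euclidean_space" and \<beta> :: "'v \<Rightarrow> real" and C :: "'a set"
  assumes finV: "finite V" and neV: "V \<noteq> {}"
    and C: "C = {x. \<forall>v\<in>V. \<alpha> v \<bullet> x \<le> \<beta> v}" and bounded: "bounded C"
    and strict: "\<exists>x. \<forall>v\<in>V. \<alpha> v \<bullet> x < \<beta> v"
    and irredundant: "\<And>v w. v \<in> V \<Longrightarrow> w \<in> V \<Longrightarrow> v \<noteq> w \<Longrightarrow> \<exists>x\<in>C. \<alpha> v \<bullet> x = \<beta> v \<and> \<alpha> w \<bullet> x \<noteq> \<beta> w"
    and nonempty: "\<And>v. v \<in> V \<Longrightarrow> \<exists>x\<in>C. \<alpha> v \<bullet> x = \<beta> v"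
begin

definition tight :: "'a \<Rightarrow> 'v set" where
  "tight x = {v\<in>V. \<alpha> v \<bullet> x = \<beta> v}"

definition side :: "'v \<Rightarrow> 'a set" where
  "side v = C \<inter> {x. \<alpha> v \<bullet> x = \<beta> v}"

lemma polytope: "polytope C"
proof -
  have "C = \<Inter>((\<lambda>v. {x. \<alpha> v \<bullet> x \<le> \<beta> v}) ` V)" unfolding C by auto
  also have "polyhedron \<dots>" using finV by (intro polyhedron_Inter) (auto intro: polyhedron_halfspace_le)
  finally show ?thesis using bounded by (simp add: polytope_eq_bounded_polyhedron)
qed

lemma convex: "convex C"
  using polytope by (rule polytope_imp_convex)

lemma aff_dim: "aff_dim C = DIM('a)"
proof (rule aff_dim_nonempty_interior)
  obtain x where x: "\<forall>v\<in>V. \<alpha> v \<bullet> x < \<beta> v" using strict by auto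
  have "open (\<Inter>v\<in>V. {x. \<alpha> v \<bullet> x < \<beta> v})" using finV by (intro open_INT) (auto intro: open_halfspace_lt)
  moreover have "(\<Inter>v\<in>V. {x. \<alpha> v \<bullet> x < \<beta> v}) \<subseteq> C" unfolding C by (auto intro: less_imp_le)
  ultimately have "(\<Inter>v\<in>V. {x. \<alpha> v \<bullet> x < \<beta> v}) \<subseteq> interior C" by (rule interior_maximal[rotated])
  then show "interior C \<noteq> {}" using x by auto
qed

lemma side_face: "v \<in> V \<Longrightarrow> side v face_of C"
  unfolding side_def by (rule face_of_Int_supporting_hyperplane_le[OF convex]) (auto simp: C)

lemma side_ne:
  assumes "v \<in> V" shows "side v \<noteq> C"
proof
  assume s: "side v = C"
  obtain x where x: "\<forall>v\<in>V. \<alpha> v \<bullet> x < \<beta> v" using strict by auto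
  then have "x \<in> C" unfolding C by (auto intro: less_imp_le)
  then have "x \<in> side v" using s by simp
  then show False using x assms unfolding side_def by auto
qed

lemma proper_face_subset_side:
  assumes "F face_of C" "F \<noteq> C"
  obtains v where "v \<in> V" "F \<subseteq> side v"
proof -
  obtain v where "v \<in> V" "F \<subseteq> {x. \<alpha> v \<bullet> x = \<beta> v}"
    by (rule proper_face_subset_supporting[OF finV neV C assms])
  then show ?thesis using that face_of_imp_subset[OF assms(1)] unfolding side_def by auto
qed

lemma side_subset_imp_eq: "v \<in> V \<Longrightarrow> w \<in> V \<Longrightarrow> side v \<subseteq> side w \<Longrightarrow> v = w"
  using irredundant[of v w] unfolding side_def by auto

text \<open>The side lies in a facet G, and G, being a proper face, lies in some side of w.
  Irredundancy forces v = w, which squeezes G to the side of v.\<close>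

lemma side_facet:
  assumes "v \<in> V" shows "side v facet_of C"
proof -
  have ne: "side v \<noteq> {}" using nonempty[OF assms] unfolding side_def by auto
  obtain G where G: "G facet_of C" "side v \<subseteq> G"
    using face_of_polyhedron_subset_facet[OF polytope_imp_polyhedron[OF polytope] side_face[OF assms] ne
      side_ne[OF assms]] .
  obtain w where w: "w \<in> V" "G \<subseteq> side w"
    using proper_face_subset_side[OF facet_of_imp_face_of[OF G(1)] facet_ne[OF G(1)]] .
  have "v = w" by (rule side_subset_imp_eq[OF assms w(1) subset_trans[OF G(2) w(2)]])
  then have "side v = G" using G(2) w(2) by auto
  then show ?thesis using G(1) by simp
qed

lemma facets: "{F. F facet_of C} = side ` V"
proof
  show "{F. F facet_of C} \<subseteq> side ` V"
  proof
    fix F assume "F \<in> {F. F facet_of C}"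
    then have F: "F facet_of C" by simp
    obtain w where w: "w \<in> V" "F \<subseteq> side w"
      using proper_face_subset_side[OF facet_of_imp_face_of[OF F] facet_ne[OF F]] .
    then have "F = side w" using facet_maximal[OF convex F side_face side_ne] by simp
    then show "F \<in> side ` V" using w(1) by simp
  qed
qed (auto intro: side_facet)

lemma inj_side: "inj_on side V"
  by (rule inj_onI) (simp add: side_subset_imp_eq)

lemma Inter_side: "X \<noteq> {} \<Longrightarrow> X \<subseteq> V \<Longrightarrow> \<Inter>(side ` X) = {x\<in>C. X \<subseteq> tight x}"
  unfolding side_def tight_def by auto

lemma C_nonempty: "C \<noteq> {}"
  using strict unfolding C by (auto intro: less_imp_le)

lemma facet_nerve_iso:
  assumes L: "\<And>X. X \<in> L \<longleftrightarrow> X \<subseteq> V \<and> (\<exists>x\<in>C. X \<subseteq> tight x)"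
  shows "simp_iso L (facet_nerve C)"
proof (rule simp_isoI[OF inj_side])
  fix X assume X: "X \<subseteq> V"
  have "side ` X \<in> facet_nerve C \<longleftrightarrow> \<Inter>(side ` X) \<noteq> {}"
    unfolding facet_nerve_def facets using image_mono[OF X, of side] by simp
  also have "\<dots> \<longleftrightarrow> (\<exists>x\<in>C. X \<subseteq> tight x)"
  proof (cases "X = {}")
    \<comment> \<open>The intersection of the empty family is \<open>UNIV\<close>, so the
      equivalence here amounts to C being nonempty.\<close>
    case True then show ?thesis using C_nonempty by auto
  next
    case False then show ?thesis unfolding Inter_side[OF False X] by auto
  qed
  finally show "X \<in> L \<longleftrightarrow> side ` X \<in> facet_nerve C" using X L by simp
next
  fix v assume v: "v \<in> V" then show "{v} \<in> L"
    using nonempty[OF v] unfolding L tight_def by auto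
next
  fix Y assume "Y \<in> facet_nerve C" then show "Y \<subseteq> side ` V"
    unfolding facet_nerve_def facets by simp
qed (simp add: L)

text \<open>With fewer tight inequalities than dimensions, one can move in a direction orthogonal to all
  their normals.\<close>
lemma extreme_point_card_tight:
  assumes x: "x extreme_point_of C"
  shows "DIM('a) \<le> card (tight x)"
proof (rule ccontr)
  assume small: "\<not> ?thesis"
  have fin: "finite (tight x)" using finV unfolding tight_def by simp
  have "dim (\<alpha> ` tight x) \<le> card (\<alpha> ` tight x)" using fin by (intro dim_le_card') simp
  also have "\<dots> \<le> card (tight x)" using fin by (rule card_image_le)
  also have "\<dots> < DIM('a)" using small by simp
  finally obtain d where d: "d \<noteq> 0" "span (\<alpha> ` tight x) \<subseteq> {y. d \<bullet> y = 0}"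
    using lowdim_subset_hyperplane by metis
  have d0: "\<alpha> v \<bullet> d = 0" if "v \<in> tight x" for v
  proof -
    have "\<alpha> v \<in> span (\<alpha> ` tight x)" using that by (intro span_base imageI)
    then show ?thesis using d(2) by (auto simp: inner_commute)
  qed
  have xC: "x \<in> C" using x unfolding extreme_point_of_def by simp
  \<comment> \<open>The absolute value makes the step length e safe for both d and -d. An inequality
    whose left side varies along d is slack and allows its slack divided by the rate of change;
    finitely many such bounds have a positive minimum.\<close>
  have "\<exists>e>0. \<forall>v\<in>W. \<alpha> v \<bullet> x + e * \<bar>\<alpha> v \<bullet> d\<bar> \<le> \<beta> v" if "finite W" "W \<subseteq> V" for W
    using that
  proof (induction W rule: finite_induct)
    case empty then show ?case by (intro exI[of _ 1]) simp
  next
    case (insert w W)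
    then obtain e where e: "e > 0" "\<forall>v\<in>W. \<alpha> v \<bullet> x + e * \<bar>\<alpha> v \<bullet> d\<bar> \<le> \<beta> v" by auto
    have "\<exists>e'>0. \<alpha> w \<bullet> x + e' * \<bar>\<alpha> w \<bullet> d\<bar> \<le> \<beta> w"
    proof (cases "\<alpha> w \<bullet> d = 0")
      case True
      then show ?thesis using xC insert.prems unfolding C by (intro exI[of _ 1]) auto
    next
      case False
      then have "w \<notin> tight x" using d0 by auto
      then have "\<alpha> w \<bullet> x < \<beta> w" using xC insert.prems unfolding C tight_def by (auto simp: less_le)
      then show ?thesis using False
        by (intro exI[of _ "(\<beta> w - \<alpha> w \<bullet> x) / \<bar>\<alpha> w \<bullet> d\<bar>"]) simp
    qed
    then obtain e' where e': "e' > 0" "\<alpha> w \<bullet> x + e' * \<bar>\<alpha> w \<bullet> d\<bar> \<le> \<beta> w" by auto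
    have mono: "\<alpha> v \<bullet> x + min e e' * \<bar>\<alpha> v \<bullet> d\<bar> \<le> \<beta> v"
      if "\<alpha> v \<bullet> x + t * \<bar>\<alpha> v \<bullet> d\<bar> \<le> \<beta> v" "min e e' \<le> t" for v t
      using mult_right_mono[OF that(2), of "\<bar>\<alpha> v \<bullet> d\<bar>"] that(1) by simp
    show ?case
    proof (intro exI[of _ "min e e'"] conjI ballI)
      show "min e e' > 0" using e(1) e'(1) by simp
      fix v assume "v \<in> insert w W"
      then consider "v = w" | "v \<in> W" by auto
      then show "\<alpha> v \<bullet> x + min e e' * \<bar>\<alpha> v \<bullet> d\<bar> \<le> \<beta> v"
      proof cases
        case 1 show ?thesis by (rule mono[of _ e']) (use e' 1 in simp_all)
      next
        case 2 show ?thesis by (rule mono[of _ e]) (use e 2 in simp_all)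
      qed
    qed
  qed
  from this[OF finV subset_refl] obtain e where e: "e > 0" "\<forall>v\<in>V. \<alpha> v \<bullet> x + e * \<bar>\<alpha> v \<bullet> d\<bar> \<le> \<beta> v"
    by auto
  have in1: "x + t *\<^sub>R d \<in> C" if "\<bar>t\<bar> = e" for t
  proof -
    have "t * (\<alpha> v \<bullet> d) \<le> e * \<bar>\<alpha> v \<bullet> d\<bar>" for v
      using abs_ge_self[of "t * (\<alpha> v \<bullet> d)"] that by (simp add: abs_mult)
    then have "\<alpha> v \<bullet> x + t * (\<alpha> v \<bullet> d) \<le> \<beta> v" if "v \<in> V" for v
      using e(2) that by (meson add_left_mono order_trans)
    then show ?thesis unfolding C by (simp add: inner_add_right)
  qed
  have "x + (-e) *\<^sub>R d \<noteq> x + e *\<^sub>R d"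
  proof
    assume "x + (-e) *\<^sub>R d = x + e *\<^sub>R d"
    then have "(2 * e) *\<^sub>R d = 0" by (simp add: algebra_simps scaleR_2 flip: scaleR_scaleR)
    then show False using e(1) d(1) by simp
  qed
  then have mem: "midpoint (x + (-e) *\<^sub>R d) (x + e *\<^sub>R d) \<in> open_segment (x + (-e) *\<^sub>R d) (x + e *\<^sub>R d)"
    by simp
  have mid: "midpoint (x + (-e) *\<^sub>R d) (x + e *\<^sub>R d) = x"
    by (simp add: midpoint_def algebra_simps flip: scaleR_2)
  note mem[unfolded mid]
  moreover have "x + (-e) *\<^sub>R d \<in> C" "x + e *\<^sub>R d \<in> C" using in1[of "-e"] in1[of e] e(1) by simp_all
  moreover have "\<forall>a\<in>C. \<forall>b\<in>C. x \<notin> open_segment a b" using x unfolding extreme_point_of_def by simp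
  ultimately show False by simp
qed

text \<open>At an extreme point the number of facets is the number of tight inequalities, which is
  bounded below by the dimension; the assumption is the opposite bound.\<close>

lemma simple:
  assumes "\<And>x. x \<in> C \<Longrightarrow> card (tight x) \<le> DIM('a)"
  shows "simple_polytope C"
  unfolding simple_polytope_def
proof (intro conjI allI impI polytope)
  fix x assume x: "x extreme_point_of C"
  then have xC: "x \<in> C" unfolding extreme_point_of_def by simp
  have "{F. F facet_of C \<and> x \<in> F} = {F\<in>side ` V. x \<in> F}" unfolding facets[symmetric] by simp
  also have "\<dots> = side ` tight x" using xC unfolding side_def tight_def by auto
  finally have "card {F. F facet_of C \<and> x \<in> F} = card (tight x)"
    using card_image[OF inj_on_subset[OF inj_side, of "tight x"]] by (simp add: tight_def)
  then show "int (card {F. F facet_of C \<and> x \<in> F}) = aff_dim C"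
    using assms[OF xC] extreme_point_card_tight[OF x] aff_dim by simp
qed

text \<open>Only inclusions of faces pass through f, so each facet F of Q is assigned some side
  containing \<open>f F\<close>, and F gets the colour of that side. The preimage of the side is a
  proper face above F, hence equal to F, and so the assignment is injective. If two facets meet,
  their images share a point at which both assigned sides are tight, and \<kappa> separates them
  there.\<close>

lemma comb_equiv_proper_colouring:
  fixes Q :: "'b::euclidean_space set"
  assumes Q: "polytope Q" and eq: "comb_equiv Q C"
    and col: "\<And>x. x \<in> C \<Longrightarrow> inj_on \<kappa> (tight x)" and colk: "\<And>v. v \<in> V \<Longrightarrow> \<kappa> v < k"
  shows "\<exists>c. proper_colouring (facet_nerve Q) k c"
proof -
  obtain f where f: "bij_betw f {F. F face_of Q} {G. G face_of C}"
    and mono': "\<forall>F1 F2. F1 face_of Q \<longrightarrow> F2 face_of Q \<longrightarrow> (F1 \<subseteq> F2 \<longleftrightarrow> f F1 \<subseteq> f F2)"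
    using eq unfolding comb_equiv_def by (elim exE conjE)
  have mono: "F1 \<subseteq> F2 \<longleftrightarrow> f F1 \<subseteq> f F2" if "F1 face_of Q" "F2 face_of Q" for F1 F2
    using mono' that by simp
  have cQ: "convex Q" using Q by (rule polytope_imp_convex)
  have fface: "f F face_of C" if "F face_of Q" for F
    using bij_betwE[OF f] that by simp
  have finj: "F = G" if "F face_of Q" "G face_of Q" "f F = f G" for F G
    using bij_betw_imp_inj_on[OF f] that by (auto dest: inj_onD)
  have fsurj: "\<exists>F. F face_of Q \<and> f F = G" if "G face_of C" for G
  proof -
    have "G \<in> f ` {F. F face_of Q}" using bij_betw_imp_surj_on[OF f] that by simp
    then show ?thesis by auto
  qed
  have fQ: "f Q = C"
  proof
    show "f Q \<subseteq> C" using face_of_imp_subset[OF fface[OF face_of_refl[OF cQ]]] .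
    from fsurj[OF face_of_refl[OF convex]] obtain F where F: "F face_of Q" "f F = C"
      by (elim exE conjE)
    then have "f F \<subseteq> f Q" using mono[OF F(1) face_of_refl[OF cQ]] face_of_imp_subset[OF F(1)] by simp
    then show "C \<subseteq> f Q" using F(2) by simp
  qed
  \<comment> \<open>If \<open>f F\<close> is empty it lies below \<open>f {}\<close>, and so F lies
    below the empty face.\<close>
  have fempty: "F = {}" if "F face_of Q" "f F = {}" for F
    using mono[OF that(1) empty_face_of[of Q]] that by simp
  have ex: "\<exists>v\<in>V. f F \<subseteq> side v" if F: "F face_of Q" "F \<noteq> Q" for F
  proof -
    have "f F \<noteq> C" using finj[OF F(1) face_of_refl[OF cQ]] F(2) fQ by auto
    from proper_face_subset_side[OF fface[OF F(1)] this] obtain v where "v \<in> V" "f F \<subseteq> side v" .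
    then show ?thesis by auto
  qed
  define s where "s F = (SOME v. v \<in> V \<and> f F \<subseteq> side v)" for F
  have s: "s F \<in> V \<and> f F \<subseteq> side (s F)" if "F facet_of Q" for F
    unfolding s_def
    by (rule someI_ex) (use ex[OF facet_of_imp_face_of[OF that] facet_ne[OF that]] in auto)
  have sinj: "F = G" if FG: "F facet_of Q" "G facet_of Q" "s F = s G" for F G
  proof -
    have "s F \<in> V" using s[OF FG(1)] by simp
    from fsurj[OF side_face[OF this]] obtain H where H: "H face_of Q" "f H = side (s F)"
      by (elim exE conjE)
    have "H \<noteq> Q" using H(2) fQ side_ne s[OF FG(1)] by auto
    moreover have "F \<subseteq> H" "G \<subseteq> H"
      using mono[OF facet_of_imp_face_of[OF FG(1)] H(1)] mono[OF facet_of_imp_face_of[OF FG(2)] H(1)]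
        H(2) s[OF FG(1)] s[OF FG(2)] FG(3) by simp_all
    ultimately show ?thesis
      using facet_maximal[OF cQ FG(1) H(1)] facet_maximal[OF cQ FG(2) H(1)] by simp
  qed
  have "proper_colouring (facet_nerve Q) k (\<kappa> \<circ> s)"
    unfolding proper_colouring_def
  proof (intro conjI ballI allI impI)
    fix F assume "F \<in> vertices (facet_nerve Q)"
    then have "F facet_of Q" unfolding vertices_def facet_nerve_def by simp
    then show "(\<kappa> \<circ> s) F < k" using s colk by simp
  next
    fix F G assume FG: "{F, G} \<in> facet_nerve Q \<and> F \<noteq> G"
    then have F: "F facet_of Q" and G: "G facet_of Q" and ne: "F \<inter> G \<noteq> {}"
      unfolding facet_nerve_def by auto
    note F' = facet_of_imp_face_of[OF F] and G' = facet_of_imp_face_of[OF G]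
    have H: "F \<inter> G face_of Q" using F' G' by (rule face_of_Int)
    have "f (F \<inter> G) \<noteq> {}" using fempty[OF H] ne by auto
    then obtain x where x: "x \<in> f (F \<inter> G)" by auto
    moreover have "f (F \<inter> G) \<subseteq> f F" "f (F \<inter> G) \<subseteq> f G"
      using mono[OF H F'] mono[OF H G'] by simp_all
    ultimately have "x \<in> side (s F)" "x \<in> side (s G)" using s[OF F] s[OF G] by auto
    then have "x \<in> C" "s F \<in> tight x" "s G \<in> tight x"
      using s[OF F] s[OF G] unfolding side_def tight_def by auto
    moreover have "s F \<noteq> s G" using sinj[OF F G] FG by auto
    ultimately show "(\<kappa> \<circ> s) F \<noteq> (\<kappa> \<circ> s) G" using inj_onD[OF col] by auto
  qed
  then show ?thesis by (intro exI[of _ "\<kappa> \<circ> s"])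
qed

end

section \<open>The cube and the hexagonal prism\<close>

text \<open>For a hexagon: the part of X lying in it is contained in one of the six edges {(j,
  True), (k, False)}. If X does not prescribe an end point, \<open>other\<close> supplies one. Both
  the simple and the simplicial realization locate X by this edge.\<close>

lemma conflict_free_extend:
  assumes X: "X \<in> conflict_free D T" and T: "T \<noteq> {}"
    and other: "\<And>i. i \<in> T \<Longrightarrow> \<exists>j\<in>T. j \<noteq> i"
  obtains j k where "j \<in> T" "k \<in> T" "j \<noteq> k"
    "\<forall>i\<in>T. (i, True) \<in> X \<longrightarrow> i = j" "\<forall>i\<in>T. (i, False) \<in> X \<longrightarrow> i = k"
proof -
  have opp: "\<not> ((i, True) \<in> X \<and> (i, False) \<in> X)" for i using X unfolding conflict_free_iff by simp
  have uniq: "i = j" if "i \<in> T" "j \<in> T" "(i, s) \<in> X" "(j, s) \<in> X" for i j s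
    using X that unfolding conflict_free_iff by simp
  show thesis
  proof (cases "\<exists>j\<in>T. (j, True) \<in> X")
    case True
    then obtain j where j: "j \<in> T" "(j, True) \<in> X" by auto
    show thesis
    proof (cases "\<exists>k\<in>T. (k, False) \<in> X")
      case True
      then obtain k where k: "k \<in> T" "(k, False) \<in> X" by auto
      have "j \<noteq> k" using opp[of j] j k by auto
      show thesis
        by (rule that[OF j(1) k(1) \<open>j \<noteq> k\<close>]) (use uniq j k in auto)
    next
      case False
      obtain k where k: "k \<in> T" "k \<noteq> j" using other[OF j(1)] by auto
      show thesis
        by (rule that[OF j(1) k(1) k(2)[symmetric]]) (use uniq j False in auto)
    qed
  next
    case nopos: False
    show thesis
    proof (cases "\<exists>k\<in>T. (k, False) \<in> X")
      case True
      then obtain k where k: "k \<in> T" "(k, False) \<in> X" by auto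
      obtain j where j: "j \<in> T" "j \<noteq> k" using other[OF k(1)] by auto
      show thesis
        by (rule that[OF j(1) k(1) j(2)]) (use uniq k nopos in auto)
    next
      case False
      obtain j where j: "j \<in> T" using T by auto
      obtain k where k: "k \<in> T" "k \<noteq> j" using other[OF j(1)] by auto
      show thesis
        by (rule that[OF j(1) k(1) k(2)[symmetric]]) (use False nopos in auto)
    qed
  qed
qed

text \<open>Each index i gives two parallel sides, at \<open>hi i\<close> for sign True and at
  \<open>lo i\<close> for False. By \<open>realize\<close> and \<open>separate\<close>, the sets of
  sides tight at a common point are the conflict-free ones; \<open>third\<close> enters in the proof
  of irredundancy. The colours are the elements of \<open>'n\<close>, as many as there are
  dimensions. Since sides tight at one point have different colours, the same colouring also shows
  that the polytope is simple.\<close>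

locale band_polytope =
  fixes D T :: "'n::finite option set" and q :: "'n option \<Rightarrow> real ^ 'n" and lo hi :: "'n option \<Rightarrow> real"
    and \<kappa> :: "'n option \<times> bool \<Rightarrow> 'n" and C :: "(real ^ 'n) set"
  assumes D: "D \<noteq> {}"
    and third: "\<And>i j. i \<in> T \<Longrightarrow> j \<in> T \<Longrightarrow> i \<noteq> j \<Longrightarrow> \<exists>k\<in>T. k \<in> D \<and> k \<noteq> i \<and> k \<noteq> j"
    and colour: "\<And>v w. v \<in> D \<times> UNIV \<Longrightarrow> w \<in> D \<times> UNIV \<Longrightarrow> v \<noteq> w \<Longrightarrow> \<kappa> v = \<kappa> w \<Longrightarrow> conflict T v w"
    and C: "C = {x. \<forall>i\<in>D. lo i \<le> q i \<bullet> x \<and> q i \<bullet> x \<le> hi i}" and bnd: "bounded C"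
    and inner: "\<exists>x. \<forall>i\<in>D. lo i < q i \<bullet> x \<and> q i \<bullet> x < hi i"
    and realize: "\<And>X. X \<in> conflict_free D T \<Longrightarrow>
      \<exists>x\<in>C. \<forall>i. ((i, True) \<in> X \<longrightarrow> q i \<bullet> x = hi i) \<and> ((i, False) \<in> X \<longrightarrow> q i \<bullet> x = lo i)"
    and separate: "\<And>x i j. x \<in> C \<Longrightarrow> i \<in> T \<Longrightarrow> j \<in> T \<Longrightarrow> i \<noteq> j \<Longrightarrow>
      \<not> (q i \<bullet> x = hi i \<and> q j \<bullet> x = hi j) \<and> \<not> (q i \<bullet> x = lo i \<and> q j \<bullet> x = lo j)"
begin

definition normal :: "'n option \<times> bool \<Rightarrow> real ^ 'n" where
  "normal v = (if snd v then q (fst v) else - q (fst v))"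

definition bound :: "'n option \<times> bool \<Rightarrow> real" where
  "bound v = (if snd v then hi (fst v) else - lo (fst v))"

lemma tight_iff: "normal (i, s) \<bullet> x = bound (i, s) \<longleftrightarrow> q i \<bullet> x = (if s then hi i else lo i)"
  by (cases s) (auto simp: normal_def bound_def)

lemma lo_less_hi: "i \<in> D \<Longrightarrow> lo i < hi i"
  using inner by fastforce

lemma tight_not_conflict:
  assumes x: "x \<in> C" and vw: "v \<in> D \<times> UNIV" "w \<in> D \<times> UNIV"
    and tv: "normal v \<bullet> x = bound v" and tw: "normal w \<bullet> x = bound w"
  shows "\<not> conflict T v w"
proof
  obtain i s where v: "v = (i, s)" by (rule prod.exhaust)
  obtain j t where w: "w = (j, t)" by (rule prod.exhaust)
  have t: "q i \<bullet> x = (if s then hi i else lo i)" "q j \<bullet> x = (if t then hi j else lo j)"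
    using tv tw unfolding v w tight_iff by simp_all
  assume "conflict T v w"
  then consider "i = j" "s \<noteq> t" | "i \<noteq> j" "s = t" "i \<in> T" "j \<in> T"
    unfolding conflict_def v w by auto
  then show False
  proof cases
    case 1
    then show False using t lo_less_hi[of i] vw unfolding v by (auto split: if_splits)
  next
    case 2
    then show False using separate[OF x 2(3,4,1)] t by (auto split: if_splits)
  qed
qed

lemma realize_tight:
  assumes "X \<in> conflict_free D T"
  shows "\<exists>x\<in>C. \<forall>v\<in>X. normal v \<bullet> x = bound v"
proof -
  from realize[OF assms] obtain x where x: "x \<in> C"
    "\<And>i. ((i, True) \<in> X \<longrightarrow> q i \<bullet> x = hi i) \<and> ((i, False) \<in> X \<longrightarrow> q i \<bullet> x = lo i)" by auto
  have "normal v \<bullet> x = bound v" if "v \<in> X" for v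
  proof -
    obtain i s where v: "v = (i, s)" by (rule prod.exhaust)
    show ?thesis using x(2)[of i] that unfolding v tight_iff by (cases s) simp_all
  qed
  then show ?thesis using x(1) by (intro bexI[of _ x]) simp_all
qed

sublocale irredundant_polytope "D \<times> UNIV" normal bound C
proof
  show "finite (D \<times> (UNIV :: bool set))" by simp
  show "D \<times> (UNIV :: bool set) \<noteq> {}" using D by simp
  show "C = {x. \<forall>v\<in>D \<times> UNIV. normal v \<bullet> x \<le> bound v}"
    unfolding C normal_def bound_def by (auto simp: all_bool_eq)
  show "bounded C" by (rule bnd)
  show "\<exists>x. \<forall>v\<in>D \<times> UNIV. normal v \<bullet> x < bound v"
    using inner unfolding normal_def bound_def by (auto simp: all_bool_eq)
next
  fix v assume "v \<in> D \<times> (UNIV :: bool set)"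
  from realize_tight[OF conflict_free_singleton[OF this]]
  show "\<exists>x\<in>C. normal v \<bullet> x = bound v" by simp
next
  fix v w assume vw: "v \<in> D \<times> (UNIV :: bool set)" "w \<in> D \<times> (UNIV :: bool set)" "v \<noteq> w"
  obtain i s where v: "v = (i, s)" by (rule prod.exhaust)
  obtain j t where w: "w = (j, t)" by (rule prod.exhaust)
  have ij: "i \<in> D" "j \<in> D" using vw v w by simp_all
  \<comment> \<open>To keep w slack, v is made tight together with a side u in conflict with w. If v
    and w are opposite, u = v will do. Otherwise u is the side opposite to w, unless that conflicts
    with v inside T; then the third index with the sign of w serves.\<close>
  have "\<exists>u\<in>D \<times> UNIV. {v, u} \<in> conflict_free D T \<and> conflict T u w"
  proof (cases "i = j")
    case True
    then have "conflict T v w" using vw(3) by (simp add: v w conflict_def)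
    then show ?thesis using conflict_free_singleton[OF vw(1)] vw(1) by (intro bexI[of _ v]) simp_all
  next
    case ne: False
    show ?thesis
    proof (cases "i \<in> T \<and> j \<in> T \<and> s \<noteq> t")
      case True
      then obtain k where k: "k \<in> T" "k \<in> D" "k \<noteq> i" "k \<noteq> j" using third[of i j] ne by auto
      then show ?thesis using True ij
        by (intro bexI[of _ "(k, t)"]) (auto simp: conflict_free_def conflict_def v w)
    next
      case False
      then show ?thesis using ij ne
        by (intro bexI[of _ "(j, \<not> t)"]) (auto simp: conflict_free_def conflict_def v w)
    qed
  qed
  then obtain u where u: "u \<in> D \<times> UNIV" "{v, u} \<in> conflict_free D T" "conflict T u w" by auto
  from realize_tight[OF u(2)] obtain x where x: "x \<in> C" "normal v \<bullet> x = bound v" "normal u \<bullet> x = bound u"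
    by auto
  have "normal w \<bullet> x \<noteq> bound w" using tight_not_conflict[OF x(1) u(1) vw(2) x(3)] u(3) by auto
  then show "\<exists>x\<in>C. normal v \<bullet> x = bound v \<and> normal w \<bullet> x \<noteq> bound w"
    using x by (intro bexI[of _ x]) simp_all
qed

lemma conflict_free_tight_iff:
  "X \<in> conflict_free D T \<longleftrightarrow> X \<subseteq> D \<times> UNIV \<and> (\<exists>x\<in>C. X \<subseteq> tight x)"
proof
  assume X: "X \<in> conflict_free D T"
  then have "X \<subseteq> D \<times> UNIV" unfolding conflict_free_def by simp
  then show "X \<subseteq> D \<times> UNIV \<and> (\<exists>x\<in>C. X \<subseteq> tight x)"
    using realize_tight[OF X] unfolding tight_def by auto
next
  assume X: "X \<subseteq> D \<times> UNIV \<and> (\<exists>x\<in>C. X \<subseteq> tight x)"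
  then obtain x where x: "x \<in> C" "X \<subseteq> tight x" by auto
  have "\<not> conflict T v w" if "v \<in> X" "w \<in> X" for v w
    by (rule tight_not_conflict[OF x(1)]) (use x(2) that in \<open>auto simp: tight_def\<close>)
  then show "X \<in> conflict_free D T" using X unfolding conflict_free_def by simp
qed

lemma inj_colour_tight:
  assumes "x \<in> C" shows "inj_on \<kappa> (tight x)"
proof (rule inj_onI, rule ccontr)
  fix v w assume vw: "v \<in> tight x" "w \<in> tight x" "\<kappa> v = \<kappa> w" "v \<noteq> w"
  then have "conflict T v w" by (intro colour) (auto simp: tight_def)
  moreover have "\<not> conflict T v w"
    by (rule tight_not_conflict[OF assms]) (use vw in \<open>auto simp: tight_def\<close>)
  ultimately show False by simp
qed

lemma is_simple: "simple_polytope C"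
proof (rule simple)
  fix x assume "x \<in> C"
  from card_inj_on_le[OF inj_colour_tight[OF this], of UNIV]
  show "card (tight x) \<le> DIM(real ^ 'n)" by simp
qed

lemma nerve_iso: "simp_iso (conflict_free D T) (facet_nerve C)"
  using conflict_free_tight_iff by (rule facet_nerve_iso)

lemma comb_equiv_colouring:
  fixes Q :: "'b::euclidean_space set"
  assumes "polytope Q" "comb_equiv Q C"
  shows "\<exists>c. proper_colouring (facet_nerve Q) CARD('n) c"
proof -
  obtain e where e: "bij_betw e (UNIV :: 'n set) {0..<CARD('n)}"
    using ex_bij_betw_finite_nat[of "UNIV :: 'n set"] by auto
  show ?thesis
  proof (rule comb_equiv_proper_colouring[OF assms, of "e \<circ> \<kappa>"])
    fix x assume "x \<in> C"
    then show "inj_on (e \<circ> \<kappa>) (tight x)"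
      using inj_colour_tight bij_betw_imp_inj_on[OF e] by (meson comp_inj_on inj_on_subset subset_UNIV)
  next
    fix v show "(e \<circ> \<kappa>) v < CARD('n)" using bij_betwE[OF e] by simp
  qed
qed

end

section \<open>The cube as an intersection of bands\<close>

lemma unit_cube_band:
  "band_polytope (range Some :: 'n::finite option set) {} (\<lambda>i. axis (the i) 1) (\<lambda>_. 0) (\<lambda>_. 1)
    (\<lambda>v. the (fst v)) unit_cube"
proof
  show "range Some \<noteq> ({} :: 'n option set)" by simp
  show "unit_cube = {x :: real ^ 'n. \<forall>i\<in>range Some. 0 \<le> axis (the i) 1 \<bullet> x \<and> axis (the i) 1 \<bullet> x \<le> 1}"
    unfolding unit_cube_def by (auto simp: inner_axis')
  have "unit_cube \<subseteq> cbox (0 :: real ^ 'n) 1" unfolding unit_cube_def by (auto simp: mem_box_cart)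
  then show "bounded (unit_cube :: (real ^ 'n) set)" by (rule bounded_subset[OF bounded_cbox])
  show "\<exists>x :: real ^ 'n. \<forall>i\<in>range Some. 0 < axis (the i) 1 \<bullet> x \<and> axis (the i) 1 \<bullet> x < 1"
    by (intro exI[of _ "\<chi> i. 1/2"]) (simp add: inner_axis')
next
  fix X :: "('n option \<times> bool) set" assume X: "X \<in> conflict_free (range Some) {}"
  let ?x = "(\<chi> i. if (Some i, True) \<in> X then 1 else 0) :: real ^ 'n"
  have "?x \<in> unit_cube" unfolding unit_cube_def by simp
  moreover have "((i, True) \<in> X \<longrightarrow> axis (the i) 1 \<bullet> ?x = 1) \<and> ((i, False) \<in> X \<longrightarrow> axis (the i) 1 \<bullet> ?x = 0)" for i
  proof (cases i)
    case None
    then show ?thesis using X unfolding conflict_free_iff by auto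
  next
    case (Some j)
    then show ?thesis using X unfolding conflict_free_iff by (simp add: inner_axis')
  qed
  ultimately show "\<exists>x\<in>unit_cube. \<forall>i. ((i, True) \<in> X \<longrightarrow> axis (the i) 1 \<bullet> x = 1) \<and>
      ((i, False) \<in> X \<longrightarrow> axis (the i) 1 \<bullet> x = 0)"
    by (intro bexI[of _ ?x]) simp_all
qed (auto simp: conflict_def)

text \<open>The region is the intersection of three strips. It is contained in the hull because each
  horizontal row is a segment between two points on edges of the hexagon; the edges that bound the
  rows change at height 1.\<close>

lemma hexagon_eq:
  "hexagon = {(x, y). 0 \<le> y \<and> y \<le> 2 \<and> 1 \<le> x + y \<and> x + y \<le> 4 \<and> - 1 \<le> x - y \<and> x - y \<le> 2}"
    (is "_ = ?R")
proof
  have "?R = {p. (0, 1) \<bullet> p \<ge> 0} \<inter> {p. (0, 1) \<bullet> p \<le> 2} \<inter> {p. (1, 1) \<bullet> p \<ge> 1} \<inter> {p. (1, 1) \<bullet> p \<le> 4}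
      \<inter> {p. (1, - 1) \<bullet> p \<ge> - 1} \<inter> {p. (1, - 1) \<bullet> p \<le> 2}"
    by (auto simp: inner_Pair)
  then have "convex ?R"
    by (simp only: convex_Int convex_halfspace_le convex_halfspace_ge)
  then show "hexagon \<subseteq> ?R" unfolding hexagon_def by (intro hull_minimal) auto
  have cH: "convex hexagon" unfolding hexagon_def by (rule convex_convex_hull)
  have in_H: "p \<in> {(0,1), (1,0), (2,0), (3,1), (2,2), (1,2)} \<Longrightarrow> p \<in> hexagon" for p
    unfolding hexagon_def by (rule hull_inc)
  have mix: "((1 - t) * fst p + t * fst p', (1 - t) * snd p + t * snd p') \<in> hexagon"
    if "p \<in> hexagon" "p' \<in> hexagon" "0 \<le> t" "t \<le> 1" for p p' t
  proof -
    have "(1 - t) *\<^sub>R p + t *\<^sub>R p' \<in> hexagon" by (rule convexD[OF cH that(1,2)]) (use that in auto)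
    then show ?thesis by (simp add: scaleR_prod_def)
  qed
  have row: "(x, y) \<in> hexagon" if "(l, y) \<in> hexagon" "(r, y) \<in> hexagon" "l \<le> x" "x \<le> r" "l < r" for l r x y
  proof -
    let ?t = "(x - l) / (r - l)"
    have "((1 - ?t) * l + ?t * r, (1 - ?t) * y + ?t * y) \<in> hexagon"
      using mix[OF that(1,2), of ?t] that by (simp add: field_simps)
    moreover have lin: "(1 - t) * l + t * r = l + t * (r - l)" for t l r :: real
      by (simp add: algebra_simps)
    have "(1 - ?t) * l + ?t * r = x" unfolding lin using that(5) by simp
    moreover have "(1 - ?t) * y + ?t * y = y" unfolding lin by simp
    ultimately show ?thesis by (simp only:)
  qed
  show "?R \<subseteq> hexagon"
  proof clarify
    fix x y :: real
    assume *: "0 \<le> y" "y \<le> 2" "1 \<le> x + y" "x + y \<le> 4" "- 1 \<le> x - y" "x - y \<le> 2"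
    show "(x, y) \<in> hexagon"
    proof (cases "y \<le> 1")
      case True
      have "(1 - y, y) \<in> hexagon" using mix[of "(1,0)" "(0,1)" y] in_H * True by simp
      moreover have "(2 + y, y) \<in> hexagon" using mix[of "(2,0)" "(3,1)" y] in_H * True
        by (simp add: algebra_simps)
      ultimately show ?thesis by (rule row) (use * in auto)
    next
      case False
      have "(y - 1, y) \<in> hexagon" using mix[of "(0,1)" "(1,2)" "y - 1"] in_H * False
        by (simp add: algebra_simps)
      moreover have "(4 - y, y) \<in> hexagon" using mix[of "(3,1)" "(2,2)" "y - 1"] in_H * False
        by (simp add: algebra_simps)
      ultimately show ?thesis by (rule row) (use * False in auto)
    qed
  qed
qed

text \<open>With x and y for the coordinates a and b, the signs of the functionals y, -x - y, x - y
  are chosen so that the upper sides y = 2, x + y = 1, x - y = 2 alternate with the lower ones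
  around the hexagon. Distinct sides of equal sign are then disjoint, as \<open>conflict\<close>
  demands.\<close>

definition prism_normal :: "'n \<Rightarrow> 'n \<Rightarrow> 'n::finite option \<Rightarrow> real ^ 'n" where
  "prism_normal a b i = (case i of None \<Rightarrow> axis b 1
     | Some j \<Rightarrow> if j = a then - axis a 1 - axis b 1 else if j = b then axis a 1 - axis b 1 else axis j 1)"

definition prism_lo :: "'n \<Rightarrow> 'n \<Rightarrow> 'n option \<Rightarrow> real" where
  "prism_lo a b i = (case i of None \<Rightarrow> 0 | Some j \<Rightarrow> if j = a then - 4 else if j = b then - 1 else 0)"

definition prism_hi :: "'n \<Rightarrow> 'n \<Rightarrow> 'n option \<Rightarrow> real" where
  "prism_hi a b i = (case i of None \<Rightarrow> 2 | Some j \<Rightarrow> if j = a then - 1 else if j = b then 2 else 1)"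

lemma prism_normal_inner:
  "prism_normal a b None \<bullet> x = x $ b"
  "prism_normal a b (Some j) \<bullet> x = (if j = a then - x $ a - x $ b else if j = b then x $ a - x $ b else x $ j)"
  by (simp_all add: prism_normal_def inner_axis' inner_diff_left)

text \<open>Alternate sides of the hexagon share a colour.\<close>
definition prism_colour :: "'n \<Rightarrow> 'n \<Rightarrow> 'n option \<times> bool \<Rightarrow> 'n" where
  "prism_colour a b v = (if fst v \<in> {None, Some a, Some b} then (if snd v then a else b) else the (fst v))"

lemma cube_hex_prism_band:
  fixes a b :: "'n::finite"
  assumes ab: "a \<noteq> b"
  shows "band_polytope UNIV {None, Some a, Some b} (prism_normal a b) (prism_lo a b) (prism_hi a b)
    (prism_colour a b) (cube_hex_prism a b)"
proof
  let ?T = "{None, Some a, Some b}"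
  show C: "cube_hex_prism a b = {x. \<forall>i\<in>UNIV. prism_lo a b i \<le> prism_normal a b i \<bullet> x \<and>
      prism_normal a b i \<bullet> x \<le> prism_hi a b i}"
    (is "_ = ?R")
  proof (rule set_eqI)
    fix x :: "real ^ 'n"
    let ?Q = "\<lambda>i. prism_lo a b i \<le> prism_normal a b i \<bullet> x \<and> prism_normal a b i \<bullet> x \<le> prism_hi a b i"
    have Q: "?Q None \<longleftrightarrow> 0 \<le> x $ b \<and> x $ b \<le> 2"
      "?Q (Some a) \<longleftrightarrow> - 4 \<le> - x $ a - x $ b \<and> - x $ a - x $ b \<le> - 1"
      "?Q (Some b) \<longleftrightarrow> - 1 \<le> x $ a - x $ b \<and> x $ a - x $ b \<le> 2"
      "j \<noteq> a \<and> j \<noteq> b \<Longrightarrow> ?Q (Some j) \<longleftrightarrow> 0 \<le> x $ j \<and> x $ j \<le> 1" for j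
      using ab by (simp_all add: prism_normal_inner prism_lo_def prism_hi_def)
    have R: "x \<in> ?R \<longleftrightarrow> (0 \<le> x $ b \<and> x $ b \<le> 2) \<and>
      (- 4 \<le> - x $ a - x $ b \<and> - x $ a - x $ b \<le> - 1) \<and> (- 1 \<le> x $ a - x $ b \<and> x $ a - x $ b \<le> 2) \<and>
      (\<forall>j. j \<noteq> a \<and> j \<noteq> b \<longrightarrow> 0 \<le> x $ j \<and> x $ j \<le> 1)"
      (is "_ \<longleftrightarrow> ?R'")
    proof
      assume "x \<in> ?R"
      then have "?Q i" for i by simp
      from this[of None] this[of "Some a"] this[of "Some b"] this[of "Some _"] show ?R'
        using Q by simp
    next
      assume R': ?R'
      have "?Q i" for i
      proof (cases i)
        case None then show ?thesis using Q(1) R' by simp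
      next
        case (Some j)
        consider "j = a" | "j = b" | "j \<noteq> a \<and> j \<noteq> b" by auto
        then show ?thesis unfolding Some by cases (use Q(2-4) R' in simp_all)
      qed
      then show "x \<in> ?R" by simp
    qed
    have "(x $ a, x $ b) \<in> hexagon \<longleftrightarrow> (0 \<le> x $ b \<and> x $ b \<le> 2) \<and>
      (- 4 \<le> - x $ a - x $ b \<and> - x $ a - x $ b \<le> - 1) \<and> (- 1 \<le> x $ a - x $ b \<and> x $ a - x $ b \<le> 2)"
      unfolding hexagon_eq by auto
    then show "x \<in> cube_hex_prism a b \<longleftrightarrow> x \<in> ?R"
      unfolding R unfolding cube_hex_prism_def by simp argo
  qed
  have "cube_hex_prism a b \<subseteq> cbox (\<chi> i. - 1) (\<chi> i. 4)"
  proof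
    fix x assume x: "x \<in> cube_hex_prism a b"
    have "- 1 \<le> x $ i \<and> x $ i \<le> 4" for i
    proof (cases "i = a \<or> i = b")
      case True
      then show ?thesis using x unfolding cube_hex_prism_def hexagon_eq by auto
    next
      case False
      then have "0 \<le> x $ i \<and> x $ i \<le> 1" using x unfolding cube_hex_prism_def by simp
      then show ?thesis by simp
    qed
    then show "x \<in> cbox (\<chi> i. - 1) (\<chi> i. 4)" by (simp add: mem_box_cart)
  qed
  then show "bounded (cube_hex_prism a b)" by (rule bounded_subset[OF bounded_cbox])
  show "\<exists>x. \<forall>i\<in>UNIV. prism_lo a b i < prism_normal a b i \<bullet> x \<and> prism_normal a b i \<bullet> x < prism_hi a b i"
  proof (intro exI[of _ "\<chi> i. if i = a then 3/2 else if i = b then 1 else 1/2"] ballI)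
    fix i show "prism_lo a b i < prism_normal a b i \<bullet> (\<chi> i. if i = a then 3/2 else if i = b then 1 else 1/2) \<and>
      prism_normal a b i \<bullet> (\<chi> i. if i = a then 3/2 else if i = b then 1 else 1/2) < prism_hi a b i"
      using ab by (cases i) (auto simp: prism_normal_inner prism_lo_def prism_hi_def)
  qed
  show "\<exists>k\<in>?T. k \<in> UNIV \<and> k \<noteq> i \<and> k \<noteq> j" if "i \<in> ?T" "j \<in> ?T" "i \<noteq> j" for i j
    using that ab by auto
  show "conflict ?T v w" if "v \<noteq> w" "prism_colour a b v = prism_colour a b w" for v w
  proof -
    obtain i s where v: "v = (i, s)" by (rule prod.exhaust)
    obtain j t where w: "w = (j, t)" by (rule prod.exhaust)
    show ?thesis using that ab unfolding v w prism_colour_def conflict_def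
      by (cases i; cases j) (auto split: if_splits)
  qed
  show "\<not> (prism_normal a b i \<bullet> x = prism_hi a b i \<and> prism_normal a b j \<bullet> x = prism_hi a b j) \<and>
      \<not> (prism_normal a b i \<bullet> x = prism_lo a b i \<and> prism_normal a b j \<bullet> x = prism_lo a b j)"
    if x: "x \<in> cube_hex_prism a b" and ij: "i \<in> ?T" "j \<in> ?T" "i \<noteq> j" for x i j
  proof -
    have "0 \<le> x $ b \<and> x $ b \<le> 2 \<and> 1 \<le> x $ a + x $ b \<and> x $ a + x $ b \<le> 4 \<and> - 1 \<le> x $ a - x $ b \<and> x $ a - x $ b \<le> 2"
      using x unfolding cube_hex_prism_def hexagon_eq by simp
    then show ?thesis using ij ab by (auto simp: prism_normal_inner prism_lo_def prism_hi_def)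
  qed
  fix X assume X: "X \<in> conflict_free UNIV ?T"
  have ne: "?T \<noteq> {}" by simp
  have other: "\<exists>j\<in>?T. j \<noteq> i" if "i \<in> ?T" for i using that ab by auto
  obtain j k where jk: "j \<in> ?T" "k \<in> ?T" "j \<noteq> k"
    "\<forall>i\<in>?T. (i, True) \<in> X \<longrightarrow> i = j" "\<forall>i\<in>?T. (i, False) \<in> X \<longrightarrow> i = k"
    using conflict_free_extend[OF X ne other] .
  have "\<exists>x y. (x, y) \<in> hexagon \<and> (\<forall>z. z $ a = x \<longrightarrow> z $ b = y \<longrightarrow>
      prism_normal a b j \<bullet> z = prism_hi a b j \<and> prism_normal a b k \<bullet> z = prism_lo a b k)"
  proof -
    let ?P = "\<lambda>x y. (x, y) \<in> hexagon \<and> (\<forall>z. z $ a = x \<longrightarrow> z $ b = y \<longrightarrow>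
      prism_normal a b j \<bullet> z = prism_hi a b j \<and> prism_normal a b k \<bullet> z = prism_lo a b k)"
    consider "j = None" "k = Some a" | "j = None" "k = Some b" | "j = Some a" "k = None"
      | "j = Some a" "k = Some b" | "j = Some b" "k = None" | "j = Some b" "k = Some a"
      using jk(1-3) by auto
    \<comment> \<open>The six vertices of the hexagon in the order of the cases; each is the
      intersection of the upper side of j with the lower side of k.\<close>
    then have "?P 2 2 \<or> ?P 1 2 \<or> ?P 1 0 \<or> ?P 0 1 \<or> ?P 2 0 \<or> ?P 3 1"
      using ab by cases (simp_all add: hexagon_eq prism_normal_inner prism_lo_def prism_hi_def)
    then show ?thesis by (elim disjE) (rule exI, rule exI, assumption)+
  qed
  then obtain x y where xy: "(x, y) \<in> hexagon" and xyz: "\<forall>z. z $ a = x \<longrightarrow> z $ b = y \<longrightarrow>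
      prism_normal a b j \<bullet> z = prism_hi a b j \<and> prism_normal a b k \<bullet> z = prism_lo a b k"
    by (elim exE conjE)
  \<comment> \<open>The edge (j, k) fixes the hexagon coordinates; the cube coordinates default to
    the lower side.\<close>
  define z :: "real ^ 'n" where
    "z = (\<chi> i. if i = a then x else if i = b then y else if (Some i, True) \<in> X then 1 else 0)"
  have za: "z $ a = x" and zb: "z $ b = y" using ab by (simp_all add: z_def)
  then have z: "prism_normal a b j \<bullet> z = prism_hi a b j" "prism_normal a b k \<bullet> z = prism_lo a b k"
    using xyz by simp_all
  have "z \<in> cube_hex_prism a b" unfolding cube_hex_prism_def using xy za zb by (simp add: z_def)
  moreover have "((i, True) \<in> X \<longrightarrow> prism_normal a b i \<bullet> z = prism_hi a b i) \<and>
      ((i, False) \<in> X \<longrightarrow> prism_normal a b i \<bullet> z = prism_lo a b i)" for i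
  proof (cases "i \<in> ?T")
    case True
    show ?thesis
    proof (intro conjI impI)
      assume "(i, True) \<in> X"
      then have "i = j" using bspec[OF jk(4) True] by simp
      then show "prism_normal a b i \<bullet> z = prism_hi a b i" using z(1) by simp
    next
      assume "(i, False) \<in> X"
      then have "i = k" using bspec[OF jk(5) True] by simp
      then show "prism_normal a b i \<bullet> z = prism_lo a b i" using z(2) by simp
    qed
  next
    case False
    then obtain l where l: "i = Some l" "l \<noteq> a" "l \<noteq> b" by (cases i) auto
    have "\<not> ((i, True) \<in> X \<and> (i, False) \<in> X)" using X unfolding conflict_free_iff by simp
    then show ?thesis using l by (simp add: prism_normal_inner prism_lo_def prism_hi_def z_def)
  qed
  ultimately show "\<exists>x\<in>cube_hex_prism a b. \<forall>i. ((i, True) \<in> X \<longrightarrow> prism_normal a b i \<bullet> x = prism_hi a b i) \<and>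
      ((i, False) \<in> X \<longrightarrow> prism_normal a b i \<bullet> x = prism_lo a b i)"
    by (intro bexI[of _ z]) simp_all
qed simp

section \<open>Centrally symmetric simplicial polytopes\<close>

text \<open>If v lay in the span of the other vectors, its functional d would vanish on v as
  well.\<close>

lemma independent_if_dual:
  fixes S :: "'a::euclidean_space set"
  assumes "\<And>v. v \<in> S \<Longrightarrow> \<exists>d. d \<bullet> v \<noteq> 0 \<and> (\<forall>u\<in>S - {v}. d \<bullet> u = 0)"
  shows "independent S"
  unfolding dependent_def
proof
  assume "\<exists>a\<in>S. a \<in> span (S - {a})"
  then obtain v where v: "v \<in> S" "v \<in> span (S - {v})" by auto
  from assms[OF v(1)] obtain d where d: "d \<bullet> v \<noteq> 0" "\<forall>u\<in>S - {v}. d \<bullet> u = 0" by auto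
  have "orthogonal d v"
    by (rule orthogonal_to_span[OF v(2)]) (use d(2) in \<open>simp add: orthogonal_def\<close>)
  then show False using d(1) by (simp add: orthogonal_def)
qed

definition sign :: "bool \<Rightarrow> real" where
  "sign s = (if s then 1 else - 1)"

text \<open>A function \<open>g \<in> G\<close> gives a facet of the convex hull of the \<open>\<plusminus> p i\<close>: the one with vertices
  \<open>g i *\<^sub>R p i\<close> for \<open>g i \<noteq> 0\<close> and with normal \<open>w g\<close>. Assumption \<open>cone\<close> says that the cones over
  these facets cover the space.\<close>
locale symmetric_polytope =
  fixes D :: "'i set" and p :: "'i \<Rightarrow> 'a::euclidean_space" and G :: "('i \<Rightarrow> real) set"
    and w :: "('i \<Rightarrow> real) \<Rightarrow> 'a"
  assumes finD: "finite D" and neD: "D \<noteq> {}" and finG: "finite G" and neG: "G \<noteq> {}"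
    and val: "\<And>g i. g \<in> G \<Longrightarrow> i \<in> D \<Longrightarrow> w g \<bullet> p i = g i"
    and range: "\<And>g i. g \<in> G \<Longrightarrow> i \<in> D \<Longrightarrow> g i = - 1 \<or> g i = 0 \<or> g i = 1"
    and cone: "\<And>x. \<exists>g\<in>G. \<exists>\<mu>. x = (\<Sum>i\<in>D. \<mu> i *\<^sub>R p i) \<and> (\<forall>i\<in>D. \<mu> i = \<bar>\<mu> i\<bar> * g i)"
    and vertex: "\<And>i s. i \<in> D \<Longrightarrow> \<exists>g\<in>G. sign s * g i = 1"
    and flip: "\<And>g i. g \<in> G \<Longrightarrow> i \<in> D \<Longrightarrow> g i \<noteq> 0 \<Longrightarrow>
      \<exists>h\<in>G. h i \<noteq> g i \<and> (\<forall>j\<in>D. j \<noteq> i \<longrightarrow> g j \<noteq> 0 \<longrightarrow> h j = g j)"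
begin

definition vert :: "'i \<times> bool \<Rightarrow> 'a" where
  "vert v = sign (snd v) *\<^sub>R p (fst v)"

definition P :: "'a set" where
  "P = convex hull (vert ` (D \<times> UNIV))"

definition star :: "('i \<Rightarrow> real) \<Rightarrow> ('i \<times> bool) set" where
  "star g = {v \<in> D \<times> UNIV. sign (snd v) * g (fst v) = 1}"

lemma w_vert: "g \<in> G \<Longrightarrow> v \<in> D \<times> UNIV \<Longrightarrow> w g \<bullet> vert v = sign (snd v) * g (fst v)"
  using val[of g "fst v"] by (auto simp: vert_def)

lemma w_vert_le: "g \<in> G \<Longrightarrow> v \<in> D \<times> UNIV \<Longrightarrow> w g \<bullet> vert v \<le> 1"
  using w_vert[of g v] range[of g "fst v"] by (auto simp: sign_def)

lemma w_vert_eq_iff: "g \<in> G \<Longrightarrow> v \<in> D \<times> UNIV \<Longrightarrow> w g \<bullet> vert v = 1 \<longleftrightarrow> v \<in> star g"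
  using w_vert[of g v] by (simp add: star_def)

lemma vert_in_P: "v \<in> D \<times> UNIV \<Longrightarrow> vert v \<in> P"
  unfolding P_def by (intro hull_inc imageI)

lemma convex_P: "convex P"
  unfolding P_def by (rule convex_convex_hull)

lemma zero_in_P: "0 \<in> P"
proof -
  obtain i where i: "i \<in> D" using neD by auto
  have "(1/2) *\<^sub>R vert (i, True) + (1/2) *\<^sub>R vert (i, False) \<in> P"
    by (rule convexD[OF convex_P]) (auto intro: vert_in_P i)
  then show ?thesis by (simp add: vert_def sign_def)
qed

text \<open>By \<open>cone\<close>, x has coefficients \<mu> carrying the signs of some g. Then
  \<open>w g \<bullet> x\<close> is the sum S of their absolute values, so S is at most 1, and x is
  S times a convex combination of the points \<open>g i *\<^sub>R p i\<close> plus (1 - S) times 0,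
  all of which lie in P.\<close>

lemma P_eq: "P = {x. \<forall>g\<in>G. w g \<bullet> x \<le> 1}"
proof
  have "{x. \<forall>g\<in>G. w g \<bullet> x \<le> 1} = (\<Inter>g\<in>G. {x. w g \<bullet> x \<le> 1})" by auto
  also have "convex \<dots>" by (intro convex_INT convex_halfspace_le)
  finally show "P \<subseteq> {x. \<forall>g\<in>G. w g \<bullet> x \<le> 1}"
    unfolding P_def by (intro hull_minimal) (auto intro: w_vert_le)
next
  show "{x. \<forall>g\<in>G. w g \<bullet> x \<le> 1} \<subseteq> P"
  proof
    fix x assume x: "x \<in> {x. \<forall>g\<in>G. w g \<bullet> x \<le> 1}"
    from cone[of x] obtain g \<mu> where g: "g \<in> G" and x_eq: "x = (\<Sum>i\<in>D. \<mu> i *\<^sub>R p i)"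
      and \<mu>: "\<forall>i\<in>D. \<mu> i = \<bar>\<mu> i\<bar> * g i" by (elim bexE exE conjE)
    define y where "y i = g i *\<^sub>R p i" for i
    define S where "S = (\<Sum>i\<in>D. \<bar>\<mu> i\<bar>)"
    have "\<mu> i * g i = \<bar>\<mu> i\<bar>" if i: "i \<in> D" for i
    proof -
      have e: "\<mu> i = \<bar>\<mu> i\<bar> * g i" using \<mu> i by simp
      consider "g i = - 1" | "g i = 0" | "g i = 1" using range[OF g i] by auto
      then show ?thesis using e by cases simp_all
    qed
    then have "w g \<bullet> x = S"
      unfolding x_eq S_def by (simp add: inner_sum_right val[OF g])
    then have S1: "S \<le> 1" using x g by auto
    have S0: "S \<ge> 0" unfolding S_def by (rule sum_nonneg) simp
    have yP: "y i \<in> P" if i: "i \<in> D" for i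
    proof -
      consider "g i = - 1" | "g i = 0" | "g i = 1" using range[OF g i] by auto
      then show ?thesis
      proof cases
        case 1 then show ?thesis using vert_in_P[of "(i, False)"] i by (simp add: y_def vert_def sign_def)
      next
        case 2 then show ?thesis using zero_in_P by (simp add: y_def)
      next
        case 3 then show ?thesis using vert_in_P[of "(i, True)"] i by (simp add: y_def vert_def sign_def)
      qed
    qed
    have xy: "x = (\<Sum>i\<in>D. \<bar>\<mu> i\<bar> *\<^sub>R y i)"
    proof -
      have "\<mu> i *\<^sub>R p i = \<bar>\<mu> i\<bar> *\<^sub>R y i" if "i \<in> D" for i
        using bspec[OF \<mu> that] unfolding y_def by (metis scaleR_scaleR)
      then show ?thesis unfolding x_eq by (rule sum.cong[OF refl])
    qed
    show "x \<in> P"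
    proof (cases "S = 0")
      case True
      then have "\<forall>i\<in>D. \<bar>\<mu> i\<bar> = 0" using finD unfolding S_def by (subst (asm) sum_nonneg_eq_0_iff) simp_all
      then have "x = 0" unfolding xy by simp
      then show ?thesis using zero_in_P by simp
    next
      case False
      have "(\<Sum>i\<in>D. (\<bar>\<mu> i\<bar> / S) *\<^sub>R y i) \<in> P"
      proof (rule convex_sum[OF finD convex_P])
        show "(\<Sum>i\<in>D. \<bar>\<mu> i\<bar> / S) = 1"
          using False unfolding sum_divide_distrib[symmetric] S_def[symmetric] by simp
      qed (use S0 yP in simp_all)
      then have "S *\<^sub>R (\<Sum>i\<in>D. (\<bar>\<mu> i\<bar> / S) *\<^sub>R y i) + (1 - S) *\<^sub>R 0 \<in> P"
        by (rule convexD[OF convex_P _ zero_in_P]) (use S0 S1 in auto)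
      also have "S *\<^sub>R (\<Sum>i\<in>D. (\<bar>\<mu> i\<bar> / S) *\<^sub>R y i) + (1 - S) *\<^sub>R 0 = x"
        unfolding xy using False by (simp add: scaleR_sum_right)
      finally show ?thesis .
    qed
  qed
qed

lemma polytope_P: "polytope P"
  unfolding polytope_def P_def using finD by (intro exI[of _ "vert ` (D \<times> UNIV)"]) simp

lemma aff_dim_P: "aff_dim P = DIM('a)"
proof (rule aff_dim_nonempty_interior)
  have "open (\<Inter>g\<in>G. {x. w g \<bullet> x < 1})" using finG by (intro open_INT) (auto intro: open_halfspace_lt)
  moreover have "(\<Inter>g\<in>G. {x. w g \<bullet> x < 1}) \<subseteq> P" unfolding P_eq by (auto intro: less_imp_le)
  ultimately have "(\<Inter>g\<in>G. {x. w g \<bullet> x < 1}) \<subseteq> interior P" by (rule interior_maximal[rotated])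
  from subsetD[OF this, of 0] show "interior P \<noteq> {}" by auto
qed

lemma star_subset: "star g \<subseteq> D \<times> UNIV"
  unfolding star_def by simp

definition cell :: "('i \<Rightarrow> real) \<Rightarrow> 'a set" where
  "cell g = convex hull (vert ` star g)"

lemma cell_eq:
  assumes g: "g \<in> G" shows "P \<inter> {x. w g \<bullet> x = 1} = cell g"
proof
  have cpt: "compact (vert ` (D \<times> UNIV))" using finD by (intro finite_imp_compact) simp
  have "(P \<inter> {x. w g \<bullet> x = 1}) face_of P"
    by (rule face_of_Int_supporting_hyperplane_le[OF convex_P]) (use g P_eq in auto)
  then obtain S where S: "S \<subseteq> vert ` (D \<times> UNIV)" "P \<inter> {x. w g \<bullet> x = 1} = convex hull S"
    unfolding P_def using face_of_convex_hull_subset[OF cpt] by auto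
  have "S \<subseteq> vert ` star g"
  proof
    fix z assume z: "z \<in> S"
    then have "z \<in> P \<inter> {x. w g \<bullet> x = 1}" unfolding S(2) by (rule hull_inc)
    then have z1: "w g \<bullet> z = 1" by simp
    from z S(1) obtain v where v: "v \<in> D \<times> UNIV" "z = vert v" by auto
    then have "v \<in> star g" using w_vert_eq_iff[OF g v(1)] z1 by simp
    then show "z \<in> vert ` star g" using v(2) by simp
  qed
  then show "P \<inter> {x. w g \<bullet> x = 1} \<subseteq> cell g" unfolding S(2) cell_def by (rule hull_mono)
next
  have "vert v \<in> P \<inter> {x. w g \<bullet> x = 1}" if "v \<in> star g" for v
    using vert_in_P[of v] w_vert_eq_iff[OF g, of v] star_subset[of g] that by auto
  then show "cell g \<subseteq> P \<inter> {x. w g \<bullet> x = 1}" unfolding cell_def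
    by (intro hull_minimal convex_Int convex_P convex_hyperplane) auto
qed

lemma cell_face: "g \<in> G \<Longrightarrow> cell g face_of P"
  unfolding cell_eq[symmetric]
  by (rule face_of_Int_supporting_hyperplane_le[OF convex_P]) (auto simp: P_eq)

lemma cell_subset_ne: "g \<in> G \<Longrightarrow> F \<subseteq> cell g \<Longrightarrow> F \<noteq> P"
  unfolding cell_eq[symmetric] using zero_in_P by auto

lemma proper_face_subset_cell:
  assumes "F face_of P" "F \<noteq> P"
  obtains g where "g \<in> G" "F \<subseteq> cell g"
proof -
  obtain g where g: "g \<in> G" "F \<subseteq> {x. w g \<bullet> x = 1}"
    by (rule proper_face_subset_supporting[OF finG neG P_eq assms])
  then have "F \<subseteq> cell g" unfolding cell_eq[OF g(1), symmetric]
    using face_of_imp_subset[OF assms(1)] by simp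
  then show ?thesis using that g(1) by simp
qed

text \<open>The functional separating a vertex of a cell from the others is the difference of the normals
  of two cells that are adjacent across the opposite ridge.\<close>
lemma flip_dual:
  assumes g: "g \<in> G" and v: "v \<in> star g"
  obtains d where "d \<bullet> vert v \<noteq> 0" "\<And>u. u \<in> star g \<Longrightarrow> u \<noteq> v \<Longrightarrow> d \<bullet> vert u = 0"
proof -
  have v': "fst v \<in> D" "sign (snd v) * g (fst v) = 1" using v unfolding star_def by auto
  then have "g (fst v) \<noteq> 0" by auto
  from flip[OF g v'(1) this] obtain h where h: "h \<in> G" "h (fst v) \<noteq> g (fst v)"
    "\<forall>j\<in>D. j \<noteq> fst v \<longrightarrow> g j \<noteq> 0 \<longrightarrow> h j = g j" by auto
  have d: "(w g - w h) \<bullet> vert u = sign (snd u) * (g (fst u) - h (fst u))" if "u \<in> star g" for u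
    using w_vert[OF g] w_vert[OF h(1)] that star_subset[of g]
    by (auto simp: inner_diff_left right_diff_distrib)
  show thesis
  proof (rule that[of "w g - w h"])
    show "(w g - w h) \<bullet> vert v \<noteq> 0" unfolding d[OF v] using h(2) by (simp add: sign_def)
    fix u assume u: "u \<in> star g" "u \<noteq> v"
    then have u': "fst u \<in> D" "sign (snd u) * g (fst u) = 1" unfolding star_def by auto
    have "fst u \<noteq> fst v"
      using u(2) u'(2) v'(2) by (auto simp: sign_def prod_eq_iff split: if_splits)
    moreover have "g (fst u) \<noteq> 0" using u'(2) by auto
    ultimately show "(w g - w h) \<bullet> vert u = 0" unfolding d[OF u(1)] using h(3) u'(1) by simp
  qed
qed

text \<open>Two indices with the same vertex lie in a common star, where the functional from
  \<open>flip_dual\<close> tells them apart.\<close>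

lemma inj_vert: "inj_on vert (D \<times> UNIV)"
proof (rule inj_onI, rule ccontr)
  fix u v assume uv: "u \<in> D \<times> (UNIV :: bool set)" "v \<in> D \<times> (UNIV :: bool set)" "vert u = vert v" "u \<noteq> v"
  obtain g where g: "g \<in> G" "sign (snd u) * g (fst u) = 1"
    using vertex[of "fst u" "snd u"] uv(1) by auto
  then have u: "u \<in> star g" using uv(1) unfolding star_def by simp
  then have "v \<in> star g" using w_vert_eq_iff[OF g(1) uv(1)] w_vert_eq_iff[OF g(1) uv(2)] uv(3) by simp
  then obtain d where "d \<bullet> vert v \<noteq> 0" "\<And>u. u \<in> star g \<Longrightarrow> u \<noteq> v \<Longrightarrow> d \<bullet> vert u = 0"
    using flip_dual[OF g(1)] by metis
  then show False using u uv(3,4) by metis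
qed

lemma aff_independent_star:
  assumes g: "g \<in> G" shows "\<not> affine_dependent (vert ` star g)"
proof -
  have "independent (vert ` star g)"
  proof (rule independent_if_dual)
    fix z assume "z \<in> vert ` star g"
    then obtain v where v: "v \<in> star g" "z = vert v" by auto
    obtain d where d: "d \<bullet> vert v \<noteq> 0" "\<And>u. u \<in> star g \<Longrightarrow> u \<noteq> v \<Longrightarrow> d \<bullet> vert u = 0"
      using flip_dual[OF g v(1)] by metis
    have "d \<bullet> y = 0" if "y \<in> vert ` star g - {z}" for y
      using that d(2) v(2) by auto
    then show "\<exists>d. d \<bullet> z \<noteq> 0 \<and> (\<forall>u\<in>vert ` star g - {z}. d \<bullet> u = 0)"
      using d(1) v(2) by (intro exI[of _ d]) simp
  qed
  then show ?thesis using affine_dependent_imp_dependent by auto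
qed

lemma simplicial: "simplicial_polytope P"
  unfolding simplicial_polytope_def
proof (intro conjI allI impI polytope_P)
  fix F assume F: "F facet_of P"
  obtain g where g: "g \<in> G" "F \<subseteq> cell g"
    using proper_face_subset_cell[OF facet_of_imp_face_of[OF F] facet_ne[OF F]] .
  have FC: "F = cell g"
    by (rule facet_maximal[OF convex_P F cell_face[OF g(1)] cell_subset_ne[OF g(1) subset_refl] g(2)])
  have "aff_dim (cell g) = aff_dim P - 1" using F unfolding FC facet_of_def by simp
  moreover have "aff_dim (cell g) = int (card (vert ` star g)) - 1"
    unfolding cell_def aff_dim_convex_hull using aff_dim_affine_independent[OF aff_independent_star[OF g(1)]] by simp
  ultimately have "int (card (vert ` star g)) = (aff_dim P - 1) + 1" by simp
  then show "(aff_dim P - 1) simplex F"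
    unfolding FC cell_def using aff_independent_star[OF g(1)] by (intro simplex_convex_hull conjI)
qed

lemma extreme_points_hull:
  assumes "g \<in> G" "c \<subseteq> vert ` star g"
  shows "{v. v extreme_point_of (convex hull c)} = c"
proof -
  have "\<not> affine_dependent c" using aff_independent_star[OF assms(1)] assms(2) affine_dependent_subset by metis
  from extreme_point_of_convex_hull_affine_independent[OF this] show ?thesis by simp
qed

text \<open>A proper face lies in a cell, and a cell is a simplex, so its faces are the hulls of the
  subsets of its vertex set. The empty subset corresponds to the empty face.\<close>

lemma boundary_complex_P: "Y \<in> boundary_complex P \<longleftrightarrow> (\<exists>g\<in>G. Y \<subseteq> vert ` star g)"
proof
  assume "Y \<in> boundary_complex P"
  then obtain F where F: "F face_of P" "F \<noteq> P" and Y: "Y = {v. v extreme_point_of F}"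
    unfolding boundary_complex_def by auto
  obtain g where g: "g \<in> G" "F \<subseteq> cell g" using proper_face_subset_cell[OF F] .
  have "F face_of cell g"
    by (rule face_of_subset[OF F(1) g(2) face_of_imp_subset[OF cell_face[OF g(1)]]])
  then obtain c where c: "c \<subseteq> vert ` star g" "F = convex hull c"
    unfolding cell_def face_of_convex_hull_affine_independent[OF aff_independent_star[OF g(1)]] by auto
  have "Y = c" unfolding Y c(2) by (rule extreme_points_hull[OF g(1) c(1)])
  then show "\<exists>g\<in>G. Y \<subseteq> vert ` star g" using g(1) c(1) by auto
next
  assume "\<exists>g\<in>G. Y \<subseteq> vert ` star g"
  then obtain g where g: "g \<in> G" "Y \<subseteq> vert ` star g" by auto
  have "convex hull Y face_of cell g"
    unfolding cell_def face_of_convex_hull_affine_independent[OF aff_independent_star[OF g(1)]]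
    using g(2) by (intro exI[of _ Y]) simp
  then have "convex hull Y face_of P" using cell_face[OF g(1)] by (rule face_of_trans)
  moreover have "convex hull Y \<noteq> P"
    by (rule cell_subset_ne[OF g(1)]) (unfold cell_def, rule hull_mono[OF g(2)])
  ultimately show "Y \<in> boundary_complex P"
    unfolding boundary_complex_def mem_Collect_eq
    by (intro exI[of _ "convex hull Y"] conjI) (simp_all add: extreme_points_hull[OF g])
qed

lemma boundary_complex_iso:
  assumes L: "\<And>X. X \<in> L \<longleftrightarrow> (\<exists>g\<in>G. X \<subseteq> star g)"
  shows "simp_iso L (boundary_complex P)"
proof (rule simp_isoI[OF inj_vert])
  fix X assume "X \<in> L" then show "X \<subseteq> D \<times> UNIV" using star_subset unfolding L by (meson subset_trans)
next
  fix v assume "v \<in> D \<times> (UNIV :: bool set)"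
  then show "{v} \<in> L" using vertex[of "fst v" "snd v"] unfolding L star_def by auto
next
  fix Y assume "Y \<in> boundary_complex P"
  then show "Y \<subseteq> vert ` (D \<times> UNIV)" unfolding boundary_complex_P
    using image_mono[OF star_subset, of vert] by (meson subset_trans)
next
  fix X assume X: "X \<subseteq> D \<times> (UNIV :: bool set)"
  have "vert ` X \<subseteq> vert ` star g \<longleftrightarrow> X \<subseteq> star g" for g
    by (rule inj_on_image_subset_iff[OF inj_vert X star_subset])
  then show "X \<in> L \<longleftrightarrow> vert ` X \<in> boundary_complex P" unfolding L boundary_complex_P by simp
qed

end

lemma finite_sign_functions: "finite {g :: 'i::finite \<Rightarrow> real. \<forall>i. g i = - 1 \<or> g i = 0 \<or> g i = 1}"
proof -
  have "finite {g :: 'i \<Rightarrow> real. \<forall>i. (i \<in> UNIV \<longrightarrow> g i \<in> {- 1, 0, 1}) \<and> (i \<notin> UNIV \<longrightarrow> g i = 0)}"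
    by (rule finite_set_of_finite_funs) simp_all
  then show ?thesis by (simp add: insert_iff)
qed

section \<open>The cross-polytope\<close>

definition cross_signs :: "('n option \<Rightarrow> real) set" where
  "cross_signs = {g. (\<forall>i. g i = - 1 \<or> g i = 0 \<or> g i = 1) \<and> (\<forall>i. g (Some i) \<noteq> 0)}"

lemma cross_polytope:
  "symmetric_polytope (range Some :: 'n::finite option set) (\<lambda>i. axis (the i) 1 :: real ^ 'n) cross_signs
     (\<lambda>g. \<chi> i. g (Some i))"
proof
  show "finite (range Some :: 'n option set)" by simp
  show "range Some \<noteq> ({} :: 'n option set)" by simp
  show "finite (cross_signs :: ('n option \<Rightarrow> real) set)"
    by (rule finite_subset[OF _ finite_sign_functions]) (auto simp: cross_signs_def)
  have "(\<lambda>_. 1) \<in> (cross_signs :: ('n option \<Rightarrow> real) set)" by (simp add: cross_signs_def)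
  then show "cross_signs \<noteq> ({} :: ('n option \<Rightarrow> real) set)" by auto
next
  fix g :: "'n option \<Rightarrow> real" and i :: "'n option" assume "i \<in> range Some"
  then show "(\<chi> i. g (Some i)) \<bullet> axis (the i) 1 = g i" by (auto simp: inner_axis)
next
  fix g :: "'n option \<Rightarrow> real" and i assume "g \<in> cross_signs"
  then show "g i = - 1 \<or> g i = 0 \<or> g i = 1" by (simp add: cross_signs_def)
next
  fix x :: "real ^ 'n"
  \<comment> \<open>The orthant of x; zero coordinates are counted as positive because the signs on
    \<open>Some i\<close> must not vanish.\<close>
  let ?g = "\<lambda>i :: 'n option. if x $ the i \<ge> 0 then 1 else - 1 :: real"
  have "x = (\<Sum>i\<in>UNIV. x $ i *\<^sub>R axis i 1)"
    using basis_expansion[of x] by (simp add: scalar_mult_eq_scaleR)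
  also have "\<dots> = (\<Sum>i\<in>range Some. (x $ the i) *\<^sub>R axis (the i) 1)"
    by (subst sum.reindex) (simp_all add: o_def)
  finally have "x = (\<Sum>i\<in>range Some. (x $ the i) *\<^sub>R axis (the i) 1)" .
  moreover have "?g \<in> cross_signs" by (simp add: cross_signs_def)
  moreover have "\<forall>i\<in>range Some. x $ the i = \<bar>x $ the i\<bar> * ?g i" by simp
  ultimately show "\<exists>g\<in>cross_signs. \<exists>\<mu>. x = (\<Sum>i\<in>range Some. \<mu> i *\<^sub>R axis (the i) 1) \<and>
      (\<forall>i\<in>range Some. \<mu> i = \<bar>\<mu> i\<bar> * g i)"
    by (intro bexI[of _ ?g] exI[of _ "\<lambda>i. x $ the i"] conjI)
next
  fix i :: "'n option" and s
  show "\<exists>g\<in>cross_signs. sign s * g i = 1"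
    by (intro bexI[of _ "\<lambda>_. sign s"]) (simp_all add: sign_def cross_signs_def)
next
  fix g :: "'n option \<Rightarrow> real" and i assume g: "g \<in> cross_signs" "g i \<noteq> 0"
  have "g j = 0 \<or> g j = 1 \<or> g j = -1" for j using g(1) unfolding cross_signs_def by auto
  then have "g(i := - g i) \<in> cross_signs" using g unfolding cross_signs_def by auto
  then show "\<exists>h\<in>cross_signs. h i \<noteq> g i \<and> (\<forall>j\<in>range Some. j \<noteq> i \<longrightarrow> g j \<noteq> 0 \<longrightarrow> h j = g j)"
    using g(2) by (intro bexI[of _ "g(i := - g i)"]) auto
qed

lemma cross_conflict_free_iff:
  fixes X :: "('n::finite option \<times> bool) set"
  shows "X \<in> conflict_free (range Some) {} \<longleftrightarrow> (\<exists>g\<in>cross_signs. X \<subseteq> symmetric_polytope.star (range Some) g)"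
proof -
  interpret symmetric_polytope "range Some :: 'n option set" "\<lambda>i. axis (the i) 1 :: real ^ 'n" cross_signs
     "\<lambda>g. \<chi> i. g (Some i)" by (rule cross_polytope)
  show ?thesis
  proof
    assume X: "X \<in> conflict_free (range Some) {}"
    let ?g = "\<lambda>i. if (i, True) \<in> X then 1 else - 1 :: real"
    have "?g \<in> cross_signs" by (simp add: cross_signs_def)
    moreover have "v \<in> star ?g" if v: "v \<in> X" for v
    proof -
      obtain i s where vis: "v = (i, s)" by (rule prod.exhaust)
      have "i \<in> range Some" "\<not> ((i, True) \<in> X \<and> (i, False) \<in> X)"
        using X v vis unfolding conflict_free_iff by auto
      then show ?thesis using v unfolding vis star_def by (cases s) (auto simp: sign_def)
    qed
    ultimately show "\<exists>g\<in>cross_signs. X \<subseteq> star g" by (intro bexI[of _ ?g]) auto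
  next
    assume "\<exists>g\<in>cross_signs. X \<subseteq> star g"
    then obtain g where X: "X \<subseteq> star g" by auto
    have "\<not> ((i, True) \<in> X \<and> (i, False) \<in> X)" for i
    proof
      assume "(i, True) \<in> X \<and> (i, False) \<in> X"
      then have "(i, True) \<in> star g" "(i, False) \<in> star g" using X by auto
      then show False by (simp add: star_def sign_def)
    qed
    then show "X \<in> conflict_free (range Some) {}"
      unfolding conflict_free_iff using subset_trans[OF X star_subset] by simp
  qed
qed

section \<open>The simplicial polytope for the join with a hexagon\<close>

text \<open>On the three hexagon indices g takes each of the values 1, -1, 0 once, which encodes the
  edge from (j, True) to (k, False); elsewhere it selects one of two opposite vertices.\<close>

definition hex_signs :: "'n \<Rightarrow> 'n \<Rightarrow> ('n option \<Rightarrow> real) set" where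
  "hex_signs a b = {g. (\<forall>i. g i = - 1 \<or> g i = 0 \<or> g i = 1) \<and> (\<forall>i. i \<notin> {None, Some a, Some b} \<longrightarrow> g i \<noteq> 0) \<and>
     (\<exists>j\<in>{None, Some a, Some b}. \<exists>k\<in>{None, Some a, Some b}. j \<noteq> k \<and> g j = 1 \<and> g k = - 1 \<and>
       (\<forall>l\<in>{None, Some a, Some b}. l \<noteq> j \<longrightarrow> l \<noteq> k \<longrightarrow> g l = 0))}"

text \<open>For distinct a and b the vectors at \<open>None\<close>, \<open>Some a\<close>,
  \<open>Some b\<close> sum to zero; together with their negatives they are the vertices of a
  hexagon in a coordinate plane.\<close>

definition hex_vec :: "'n \<Rightarrow> 'n \<Rightarrow> 'n::finite option \<Rightarrow> real ^ 'n" where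
  "hex_vec a b i = (case i of None \<Rightarrow> - axis a 1 - axis b 1 | Some j \<Rightarrow> axis j 1)"

text \<open>The three values 1, -1, 0 sum to zero, just as the three vectors do. This makes the
  normal with coordinates \<open>g (Some i)\<close> take the value \<open>g None\<close> at the
  vector of \<open>None\<close>.\<close>

lemma hex_signs_sum:
  assumes "a \<noteq> b" "g \<in> hex_signs a b"
  shows "g None = - g (Some a) - g (Some b)"
proof -
  obtain j k where jk: "j \<in> {None, Some a, Some b}" "k \<in> {None, Some a, Some b}" "j \<noteq> k" "g j = 1" "g k = - 1"
    and l: "\<forall>l\<in>{None, Some a, Some b}. l \<noteq> j \<longrightarrow> l \<noteq> k \<longrightarrow> g l = 0"
    using assms(2) unfolding hex_signs_def by auto
  from jk(1-3) consider "j = None" "k = Some a" | "j = None" "k = Some b" | "j = Some a" "k = None"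
    | "j = Some a" "k = Some b" | "j = Some b" "k = None" | "j = Some b" "k = Some a"
    by auto
  then show ?thesis using jk(4,5) l assms(1) by cases simp_all
qed

lemma sort_three:
  fixes y :: "'i \<Rightarrow> real"
  assumes "distinct [a, b, c]"
  obtains j l k where "{a, b, c} = {j, l, k}" "distinct [j, l, k]" "y k \<le> y l" "y l \<le> y j"
proof -
  consider "y a \<le> y b" "y b \<le> y c" | "y a \<le> y c" "y c \<le> y b" | "y b \<le> y a" "y a \<le> y c"
    | "y b \<le> y c" "y c \<le> y a" | "y c \<le> y a" "y a \<le> y b" | "y c \<le> y b" "y b \<le> y a"
    by linarith
  then show thesis
  proof cases
    case 1 show thesis by (rule that[of c b a]) (use 1 assms in auto)
  next
    case 2 show thesis by (rule that[of b c a]) (use 2 assms in auto)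
  next
    case 3 show thesis by (rule that[of c a b]) (use 3 assms in auto)
  next
    case 4 show thesis by (rule that[of a c b]) (use 4 assms in auto)
  next
    case 5 show thesis by (rule that[of b a c]) (use 5 assms in auto)
  next
    case 6 show thesis by (rule that[of a b c]) (use 6 assms in auto)
  qed
qed

lemma hex_signsI:
  assumes "j \<in> {None, Some a, Some b}" "k \<in> {None, Some a, Some b}" "j \<noteq> k" "g j = 1" "g k = - 1"
    and "\<And>l. l \<in> {None, Some a, Some b} \<Longrightarrow> l \<noteq> j \<Longrightarrow> l \<noteq> k \<Longrightarrow> g l = 0"
    and "\<And>i. i \<notin> {None, Some a, Some b} \<Longrightarrow> g i = - 1 \<or> g i = 1"
  shows "g \<in> hex_signs a b"
proof -
  have "g i = - 1 \<or> g i = 0 \<or> g i = 1" for i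
  proof (cases "i \<in> {None, Some a, Some b}")
    case True
    then show ?thesis using assms(4,5) assms(6)[OF True] by auto
  next
    case False
    then show ?thesis using assms(7)[OF False] by auto
  qed
  moreover have "g i \<noteq> 0" if "i \<notin> {None, Some a, Some b}" for i using assms(7)[OF that] by auto
  moreover have "\<exists>j\<in>{None, Some a, Some b}. \<exists>k\<in>{None, Some a, Some b}. j \<noteq> k \<and> g j = 1 \<and> g k = - 1 \<and>
       (\<forall>l\<in>{None, Some a, Some b}. l \<noteq> j \<longrightarrow> l \<noteq> k \<longrightarrow> g l = 0)"
    by (rule bexI[OF _ assms(1)], rule bexI[OF _ assms(2)]) (use assms(3-6) in simp)
  ultimately show ?thesis unfolding hex_signs_def by simp
qed

lemma hex_signs_extend:
  fixes X :: "('n option \<times> bool) set"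
  assumes ab: "a \<noteq> b" and X: "X \<in> conflict_free UNIV {None, Some a, Some b}"
  shows "\<exists>g\<in>hex_signs a b. \<forall>(i, s)\<in>X. sign s * g i = 1"
proof -
  let ?T = "{None, Some a, Some b}"
  have ne: "?T \<noteq> {}" by simp
  have other: "\<exists>j\<in>?T. j \<noteq> i" if "i \<in> ?T" for i using that ab by auto
  obtain j k where jk: "j \<in> ?T" "k \<in> ?T" "j \<noteq> k"
    "\<forall>i\<in>?T. (i, True) \<in> X \<longrightarrow> i = j" "\<forall>i\<in>?T. (i, False) \<in> X \<longrightarrow> i = k"
    using conflict_free_extend[OF X ne other] .
  define g :: "'n option \<Rightarrow> real" where
    "g i = (if i = j then 1 else if i = k then - 1 else if i \<in> ?T then 0 else if (i, True) \<in> X then 1 else - 1)" for i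
  have "g \<in> hex_signs a b"
    by (rule hex_signsI[OF jk(1-3)]) (use jk(1-3) in \<open>auto simp: g_def\<close>)
  moreover have "sign s * g i = 1" if elem: "(i, s) \<in> X" for i s
  proof (cases "i \<in> ?T")
    case True
    then show ?thesis using elem jk(3) bspec[OF jk(4) True] bspec[OF jk(5) True]
      by (cases s) (simp_all add: g_def sign_def)
  next
    case False
    have "\<not> ((i, True) \<in> X \<and> (i, False) \<in> X)" using X unfolding conflict_free_iff by simp
    moreover have "i \<noteq> j" "i \<noteq> k" using False jk(1,2) by auto
    ultimately show ?thesis using elem False by (cases s) (simp_all add: g_def sign_def)
  qed
  ultimately show ?thesis by (intro bexI[of _ g]) auto
qed

lemma hex_polytope:
  fixes a b :: "'n::finite"
  assumes ab: "a \<noteq> b"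
  shows "symmetric_polytope (UNIV :: 'n option set) (hex_vec a b) (hex_signs a b) (\<lambda>g. \<chi> i. g (Some i))"
proof
  let ?T = "{None, Some a, Some b}"
  show "finite (UNIV :: 'n option set)" "UNIV \<noteq> ({} :: 'n option set)" by simp_all
  show "finite (hex_signs a b)"
    by (rule finite_subset[OF _ finite_sign_functions]) (auto simp: hex_signs_def)
  have "{} \<in> conflict_free UNIV ?T" by (simp add: conflict_free_def)
  from hex_signs_extend[OF ab this] show "hex_signs a b \<noteq> {}" by auto
  show "\<exists>g\<in>hex_signs a b. sign s * g i = 1" for i s
  proof -
    have "{(i, s)} \<in> conflict_free UNIV ?T" by (rule conflict_free_singleton) simp
    from hex_signs_extend[OF ab this] show ?thesis by simp
  qed
next
  fix g and i :: "'n option" assume "g \<in> hex_signs a b"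
  then show "g i = - 1 \<or> g i = 0 \<or> g i = 1" unfolding hex_signs_def by simp
next
  fix g and i :: "'n option" assume "g \<in> hex_signs a b"
  from hex_signs_sum[OF ab this] show "(\<chi> i. g (Some i)) \<bullet> hex_vec a b i = g i"
    by (cases i) (simp_all add: hex_vec_def inner_axis inner_diff_right)
next
  fix x :: "real ^ 'n"
  let ?T = "{None, Some a, Some b}"
  define y :: "'n option \<Rightarrow> real" where "y i = (case i of None \<Rightarrow> 0 | Some c \<Rightarrow> x $ c)" for i
  have "distinct [None, Some a, Some b]" using ab by simp
  then obtain j l k where T: "?T = {j, l, k}" "distinct [j, l, k]" and jlk: "y k \<le> y l" "y l \<le> y j"
    by (rule sort_three)
  \<comment> \<open>As the three hexagon vectors sum to zero, a constant may be subtracted from all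
    their coefficients. Subtracting the middle one leaves a nonnegative coefficient at j, a
    nonpositive one at k and zero at l, so x lies in the cone of the edge (j, k).\<close>
  define \<mu> where "\<mu> i = (if i \<in> ?T then y i - y l else y i)" for i
  define g :: "'n option \<Rightarrow> real" where
    "g i = (if i = j then 1 else if i = k then - 1 else if i = l then 0 else if y i \<ge> 0 then 1 else - 1)" for i
  have jT: "j \<in> ?T" and kT: "k \<in> ?T" and lT: "l \<in> ?T" unfolding T(1) by simp_all
  have Tc: "i = j \<or> i = l \<or> i = k" if "i \<in> ?T" for i using that unfolding T(1) by simp
  have g: "g \<in> hex_signs a b"
  proof (rule hex_signsI[OF jT kT])
    show "g i = - 1 \<or> g i = 1" if "i \<notin> ?T" for i
      using that unfolding T(1) by (simp add: g_def)
    show "g i = 0" if "i \<in> ?T" "i \<noteq> j" "i \<noteq> k" for i using Tc[OF that(1)] that by (simp add: g_def)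
  qed (use T(2) in \<open>auto simp: g_def\<close>)
  have \<mu>g: "\<mu> i = \<bar>\<mu> i\<bar> * g i" for i
  proof (cases "i \<in> ?T")
    case True
    then show ?thesis using Tc[OF True] jlk T(2) unfolding \<mu>_def if_P[OF True]
      by (auto simp: g_def)
  next
    case False
    then have "i \<noteq> j" "i \<noteq> k" "i \<noteq> l" using jT kT lT by auto
    then show ?thesis unfolding \<mu>_def if_not_P[OF False] by (simp add: g_def)
  qed
  have "(\<Sum>i\<in>UNIV. \<mu> i *\<^sub>R hex_vec a b i) = \<mu> None *\<^sub>R hex_vec a b None + (\<Sum>c\<in>UNIV. \<mu> (Some c) *\<^sub>R axis c 1)"
    unfolding UNIV_option_conv by (subst sum.insert) (simp_all add: sum.reindex o_def hex_vec_def)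
  also have "(\<Sum>c\<in>UNIV. \<mu> (Some c) *\<^sub>R axis c 1) = (\<chi> c. \<mu> (Some c))"
    using basis_expansion[of "\<chi> c. \<mu> (Some c)"] by (simp add: scalar_mult_eq_scaleR)
  also have "\<mu> None *\<^sub>R hex_vec a b None + (\<chi> c. \<mu> (Some c)) = x"
  proof (rule vec_eq_iff[THEN iffD2], rule allI)
    fix c
    consider "c = a" | "c = b" | "c \<noteq> a" "c \<noteq> b" by auto
    then show "(\<mu> None *\<^sub>R hex_vec a b None + (\<chi> c. \<mu> (Some c))) $ c = x $ c"
      using ab by cases (simp_all add: hex_vec_def \<mu>_def y_def axis_def)
  qed
  finally show "\<exists>g\<in>hex_signs a b. \<exists>\<mu>. x = (\<Sum>i\<in>UNIV. \<mu> i *\<^sub>R hex_vec a b i) \<and> (\<forall>i\<in>UNIV. \<mu> i = \<bar>\<mu> i\<bar> * g i)"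
    using g \<mu>g by (intro bexI[of _ g] exI[of _ \<mu>] conjI ballI) simp_all
next
  fix g and i :: "'n option" assume g: "g \<in> hex_signs a b" "g i \<noteq> 0"
  let ?T = "{None, Some a, Some b}"
  obtain j k where jk: "j \<in> ?T" "k \<in> ?T" "j \<noteq> k" "g j = 1" "g k = - 1"
    and l: "\<And>l. l \<in> ?T \<Longrightarrow> l \<noteq> j \<Longrightarrow> l \<noteq> k \<Longrightarrow> g l = 0"
    using g(1) unfolding hex_signs_def by auto
  have off: "g i = - 1 \<or> g i = 1" if "i \<notin> ?T" for i
    using g(1) that unfolding hex_signs_def by auto
  have "\<exists>l\<in>?T. l \<noteq> j \<and> l \<noteq> k" using jk(1,2) ab by auto
  then obtain t where t: "t \<in> ?T" "t \<noteq> j" "t \<noteq> k" by auto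
  have tT: "i = j \<or> i = k \<or> i = t" if "i \<in> ?T" for i using that jk(1-3) t by auto
  have gt: "g t = 0" by (rule l[OF t])
  show "\<exists>h\<in>hex_signs a b. h i \<noteq> g i \<and> (\<forall>j\<in>UNIV. j \<noteq> i \<longrightarrow> g j \<noteq> 0 \<longrightarrow> h j = g j)"
  proof (cases "i \<in> ?T")
    case False
    have "g(i := - g i) \<in> hex_signs a b"
    proof (rule hex_signsI[OF jk(1-3)])
      show "(g(i := - g i)) m = - 1 \<or> (g(i := - g i)) m = 1" if "m \<notin> ?T" for m
        using off[OF that] by auto
    qed (use False jk l in auto)
    then show ?thesis using g(2) by (intro bexI[of _ "g(i := - g i)"]) auto
  next
    case True
    then consider "i = j" | "i = k" using tT gt g(2) by auto
    then show ?thesis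
    proof cases
      case 1
      have "g(j := 0, t := 1) \<in> hex_signs a b"
      proof (rule hex_signsI[OF t(1) jk(2) t(3)])
        show "(g(j := 0, t := 1)) m = - 1 \<or> (g(j := 0, t := 1)) m = 1" if "m \<notin> ?T" for m
          using off[OF that] that jk(1) t(1) by auto
        show "(g(j := 0, t := 1)) m = 0" if "m \<in> ?T" "m \<noteq> t" "m \<noteq> k" for m
          using tT[OF that(1)] that t by auto
      qed (use jk t in auto)
      then show ?thesis using 1 jk(4) t gt by (intro bexI[of _ "g(j := 0, t := 1)"]) auto
    next
      case 2
      \<comment> \<open>The neighbouring edge that keeps (j, True).\<close>
      have "g(k := 0, t := - 1) \<in> hex_signs a b"
      proof (rule hex_signsI[OF jk(1) t(1) t(2)[symmetric]])
        show "(g(k := 0, t := - 1)) m = - 1 \<or> (g(k := 0, t := - 1)) m = 1" if "m \<notin> ?T" for m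
          using off[OF that] that jk(2) t(1) by auto
        show "(g(k := 0, t := - 1)) m = 0" if "m \<in> ?T" "m \<noteq> j" "m \<noteq> t" for m
          using tT[OF that(1)] that t by auto
      qed (use jk t in auto)
      then show ?thesis using 2 jk(5) t gt by (intro bexI[of _ "g(k := 0, t := - 1)"]) auto
    qed
  qed
qed

lemma hex_conflict_free_iff:
  fixes a b :: "'n::finite" and X :: "('n option \<times> bool) set"
  assumes ab: "a \<noteq> b"
  shows "X \<in> conflict_free UNIV {None, Some a, Some b} \<longleftrightarrow>
    (\<exists>g\<in>hex_signs a b. X \<subseteq> symmetric_polytope.star UNIV g)"
proof -
  interpret symmetric_polytope "UNIV :: 'n option set" "hex_vec a b" "hex_signs a b" "\<lambda>g. \<chi> i. g (Some i)"
    using ab by (rule hex_polytope)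
  let ?T = "{None, Some a, Some b}"
  show ?thesis
  proof
    assume "X \<in> conflict_free UNIV ?T"
    from hex_signs_extend[OF ab this] obtain g where g: "g \<in> hex_signs a b"
      and gX: "\<forall>(i, s)\<in>X. sign s * g i = 1" by (elim bexE)
    have "v \<in> star g" if "v \<in> X" for v
      using bspec[OF gX that] unfolding star_def by (cases v) simp
    then show "\<exists>g\<in>hex_signs a b. X \<subseteq> star g" by (intro bexI[OF _ g] subsetI)
  next
    assume "\<exists>g\<in>hex_signs a b. X \<subseteq> star g"
    then obtain g where g: "g \<in> hex_signs a b" and X: "X \<subseteq> star g" by auto
    obtain j k where jk: "g j = 1" "g k = - 1" "\<forall>l\<in>?T. l \<noteq> j \<longrightarrow> l \<noteq> k \<longrightarrow> g l = 0"
      using g unfolding hex_signs_def mem_Collect_eq by (elim conjE bexE)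
    have gX: "sign s * g i = 1" if "(i, s) \<in> X" for i s using X that unfolding star_def by auto
    have unique: "m = (if s then j else k)" if m: "m \<in> ?T" "(m, s) \<in> X" for m s
    proof (rule ccontr)
      assume ne: "m \<noteq> (if s then j else k)"
      have gm: "sign s * g m = 1" by (rule gX[OF m(2)])
      show False
      proof (cases s)
        case True
        then have "g m = 1" using gm by (simp add: sign_def)
        then have "m \<noteq> k" using jk(2) by auto
        then have "g m = 0" using bspec[OF jk(3) m(1)] ne True by simp
        then show False using \<open>g m = 1\<close> by simp
      next
        case False
        then have "g m = - 1" using gm by (simp add: sign_def)
        then have "m \<noteq> j" using jk(1) by auto
        then have "g m = 0" using bspec[OF jk(3) m(1)] ne False by simp
        then show False using \<open>g m = - 1\<close> by simp
      qed
    qed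
    show "X \<in> conflict_free UNIV ?T" unfolding conflict_free_iff
    proof (intro conjI allI ballI impI notI)
      fix i assume "(i, True) \<in> X \<and> (i, False) \<in> X"
      then show False using gX[of i True] gX[of i False] by (simp add: sign_def)
    next
      fix s i i' assume "i \<in> ?T" "i' \<in> ?T" "(i, s) \<in> X \<and> (i', s) \<in> X"
      then show "i = i'" using unique[of i s] unique[of i' s] by metis
    qed simp
  qed
qed

section \<open>The chromatic number of Bier spheres\<close>

lemma cross_polytope_realization:
  "\<exists>P :: (real ^ 'n::finite) set. simplicial_polytope P \<and> aff_dim P = int CARD('n) \<and>
     simp_iso (conflict_free (range Some :: 'n option set) {}) (boundary_complex P)"
proof -
  interpret symmetric_polytope "range Some :: 'n option set" "\<lambda>i. axis (the i) 1 :: real ^ 'n" cross_signs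
     "\<lambda>g. \<chi> i. g (Some i)" by (rule cross_polytope)
  have "simp_iso (conflict_free (range Some :: 'n option set) {}) (boundary_complex P)"
    by (rule boundary_complex_iso[OF cross_conflict_free_iff])
  then show ?thesis using simplicial aff_dim_P by (intro exI[of _ P]) simp
qed

lemma hex_polytope_realization:
  fixes a b :: "'n::finite"
  assumes "a \<noteq> b"
  shows "\<exists>P :: (real ^ 'n) set. simplicial_polytope P \<and> aff_dim P = int CARD('n) \<and>
     simp_iso (conflict_free UNIV {None, Some a, Some b}) (boundary_complex P)"
proof -
  interpret symmetric_polytope "UNIV :: 'n option set" "hex_vec a b" "hex_signs a b" "\<lambda>g. \<chi> i. g (Some i)"
    using assms by (rule hex_polytope)
  have "simp_iso (conflict_free UNIV {None, Some a, Some b}) (boundary_complex P)"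
    by (rule boundary_complex_iso[OF hex_conflict_free_iff[OF assms]])
  then show ?thesis using simplicial aff_dim_P by (intro exI[of _ P]) simp
qed

lemma bier_polytopalI:
  assumes "\<exists>P :: (real ^ 'n::finite) set. simplicial_polytope P \<and> aff_dim P = int CARD('n) \<and>
     simp_iso L (boundary_complex P)"
    and "simp_iso L (bier m K)"
  shows "bier_polytopal TYPE('n) m K"
proof -
  from assms(1) obtain P :: "(real ^ 'n) set" where P: "simplicial_polytope P" "aff_dim P = int CARD('n)"
    "simp_iso L (boundary_complex P)" by (elim exE conjE)
  from simp_iso_trans[OF simp_iso_sym[OF P(3)] assms(2)] P(1,2) show ?thesis
    unfolding bier_polytopal_def by (intro exI[of _ P] conjI)
qed

lemma comb_equiv_refl: "comb_equiv P P"
  unfolding comb_equiv_def by (intro exI[of _ id]) simp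

lemma (in band_polytope) is_P_K:
  assumes "simp_iso (conflict_free D T) (bier m K)"
  shows "is_P_K m K C"
  unfolding is_P_K_def
  using is_simple aff_dim simp_iso_trans[OF simp_iso_sym[OF nerve_iso] assms] by simp

lemma (in band_polytope) chromatic_number_le_of_comb_equiv:
  fixes Q :: "(real ^ 'm::finite) set"
  assumes Q: "is_P_K m K Q" and eq: "comb_equiv Q C"
  shows "chromatic_number (bier m K) \<le> CARD('n)"
proof -
  have "polytope Q" using Q unfolding is_P_K_def simple_polytope_def by simp
  from comb_equiv_colouring[OF this eq] obtain c where c: "proper_colouring (facet_nerve Q) CARD('n) c" ..
  have "simp_iso (facet_nerve Q) (bier m K)" using Q unfolding is_P_K_def by simp
  from simp_iso_proper_colouring[OF this c] obtain c' where "proper_colouring (bier m K) CARD('n) c'" ..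
  then show ?thesis by (rule chromatic_number_le)
qed

theorem mainTheorem11:
  fixes m :: nat and K :: "nat set set"
  assumes m2: "m \<ge> 2"
    and dimn: "CARD('n::finite) = m - 1"
    and K: "is_simplicial_complex_on m K"
    and Kne: "K \<noteq> full_simplex m"
  shows "(m - 1 \<le> chromatic_number (bier m K) \<and> chromatic_number (bier m K) \<le> m) \<and>
         (chromatic_number (bier m K) = m - 1 \<longleftrightarrow>
           bier_polytopal TYPE('n) m K \<and>
           ((\<exists>Q :: (real ^ 'n) set. is_P_K m K Q \<and> comb_equiv Q (unit_cube :: (real ^ 'n) set)) \<or>
            (m \<ge> 3 \<and> (\<exists>Q :: (real ^ 'n) set. is_P_K m K Q \<and>
                (\<exists>a b :: 'n. a \<noteq> b \<and> comb_equiv Q (cube_hex_prism a b))))))"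
    (is "?a \<and> (?chi = m - 1 \<longleftrightarrow> ?poly \<and> (?cube \<or> (m \<ge> 3 \<and> ?hex)))")
proof -
  interpret proper_subcomplex m K using K Kne by unfold_locales
  interpret cube: band_polytope "range Some :: 'n option set" "{}" "\<lambda>i. axis (the i) 1" "\<lambda>_. 0" "\<lambda>_. 1"
    "\<lambda>v. the (fst v)" unit_cube by (rule unit_cube_band)
  have forward: "?poly \<and> (?cube \<or> (m \<ge> 3 \<and> ?hex))" if chi: "?chi = m - 1"
  proof -
    from chromatic_number_colouring[OF proper_colouring_bier]
    obtain c where c: "proper_colouring (bier m K) (m - 1) c" unfolding chi ..
    interpret balanced_bier m K c using c by unfold_locales
    from bier_iso[OF dimn] show ?thesis
    proof
      assume iso: "simp_iso (conflict_free (range Some :: 'n option set) {}) (bier m K)"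
      have ?poly by (rule bier_polytopalI[OF cross_polytope_realization iso])
      moreover have ?cube
        by (intro exI[of _ unit_cube] conjI cube.is_P_K[OF iso] comb_equiv_refl)
      ultimately show ?thesis by simp
    next
      assume "m \<ge> 3 \<and> (\<exists>a b :: 'n. a \<noteq> b \<and> simp_iso (conflict_free UNIV {None, Some a, Some b}) (bier m K))"
      then obtain a b :: 'n where m3: "m \<ge> 3" and ab: "a \<noteq> b"
        and iso: "simp_iso (conflict_free UNIV {None, Some a, Some b}) (bier m K)" by (elim exE conjE)
      have ?poly by (rule bier_polytopalI[OF hex_polytope_realization[OF ab] iso])
      moreover have ?hex
        by (intro exI[of _ "cube_hex_prism a b"] exI[of _ a] exI[of _ b] conjI ab comb_equiv_refl
            band_polytope.is_P_K[OF cube_hex_prism_band[OF ab] iso])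
      ultimately show ?thesis using m3 by simp
    qed
  qed
  \<comment> \<open>The colouring of the facets gives the upper bound m - 1, which meets the general
    lower bound.\<close>
  have backward: "?chi = m - 1" if "?cube \<or> (m \<ge> 3 \<and> ?hex)"
  proof -
    from that have "?chi \<le> CARD('n)"
    proof (elim disjE exE conjE)
      fix Q :: "(real ^ 'n) set" assume "is_P_K m K Q" "comb_equiv Q (unit_cube :: (real ^ 'n) set)"
      then show ?thesis by (rule cube.chromatic_number_le_of_comb_equiv)
    next
      fix Q :: "(real ^ 'n) set" and a b :: 'n
      assume "is_P_K m K Q" "a \<noteq> b" "comb_equiv Q (cube_hex_prism a b)"
      then show ?thesis
        using band_polytope.chromatic_number_le_of_comb_equiv[OF cube_hex_prism_band] by metis
    qed
    then show ?thesis using chromatic_number_bounds(1) dimn by simp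
  qed
  show ?thesis using chromatic_number_bounds forward backward by (intro conjI iffI) simp_all
qed

end
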